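(* Let $p>3$ be a prime and $x\in\mathbb Z_p$. Put $T(x)=\dfrac{B_{p^2(p-1)}(-x)-B_{p^2(p-1)}}{p^2(p-1)}$. Then $$V_p(x)\equiv1-2\binom xp\binom{-1-x}p+2pT(x)+2p^2T(x)^2\pmod{p^3}.$$ Consequently $V_p\equiv8$, $V_p^{(3)}\equiv15$, $V_p^{(4)}\equiv40$ and $V_p^{(6)}\equiv312\pmod{p^3}$.
   Context: For real $x$ and integer $k\ge0$, $\binom xk=x(x-1)\cdots(x-k+1)/k!$. $V_n(x)=\sum_{k=0}^n\binom nk\binom{n+k}k(-1)^k\binom xk\binom{-1-x}k$. $\mathbb Z_p$ is the set of rationals with denominator prime to $p$; congruences modulo powers of $p$ are in $\mathbb Z_p$. Bernoulli numbers: $B_0=1$, $\sum_{k=0}^{n-1}\binom nkB_k=0$ ($n\ge2$); $B_n(x)=\sum_{k=0}^n\binom nkB_kx^{n-k}$. $V_n=16^nV_n(-\tfrac12)=\sum_{k=0}^n\binom{2k}k^2\binom{2n-2k}{n-k}^2$, $V_n^{(3)}=27^nV_n(-\tfrac13)=\sum_{k=0}^n\binom nk\binom{n+k}k(-1)^k\binom{2k}k\binom{3k}k27^{n-k}$, $V_n^{(4)}=64^nV_n(-\tfrac14)=\sum_{k=0}^n\binom nk\binom{n+k}k(-1)^k\binom{2k}k\binom{4k}{2k}64^{n-k}$, $V_n^{(6)}=432^nV_n(-\tfrac16)=\sum_{k=0}^n\binom nk\binom{n+k}k(-1)^k\binom{3k}k\binom{6k}{3k}432^{n-k}$. *)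

theory Defs
  imports Complex_Main "HOL-Computational_Algebra.Primes"
begin

text \<open>\<open>quotient_of\<close> returns the reduced fraction with positive denominator.\<close>

definition Zp :: "nat \<Rightarrow> rat set" where
  "Zp p = {x. coprime (snd (quotient_of x)) (int p)}"

text \<open>Congruence modulo \<open>p ^ m\<close> in \<open>Zp p\<close>; both sides are required to be elements of \<open>Zp p\<close>.\<close>

definition Zp_cong :: "nat \<Rightarrow> nat \<Rightarrow> rat \<Rightarrow> rat \<Rightarrow> bool" where
  "Zp_cong p m a b \<longleftrightarrow> a \<in> Zp p \<and> b \<in> Zp p \<and> (\<exists>c\<in>Zp p. a - b = of_nat p ^ m * c)"

definition V_poly :: "nat \<Rightarrow> rat \<Rightarrow> rat" where
  "V_poly n x = (\<Sum>k=0..n. of_nat (n choose k) * of_nat ((n + k) choose k) * (-1) ^ k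
                   * (x gchoose k) * ((-1 - x) gchoose k))"

definition V :: "nat \<Rightarrow> rat" where
  "V n = 16 ^ n * V_poly n (- 1 / 2)"

definition V3 :: "nat \<Rightarrow> rat" where
  "V3 n = 27 ^ n * V_poly n (- 1 / 3)"

definition V4 :: "nat \<Rightarrow> rat" where
  "V4 n = 64 ^ n * V_poly n (- 1 / 4)"

definition V6 :: "nat \<Rightarrow> rat" where
  "V6 n = 432 ^ n * V_poly n (- 1 / 6)"

text \<open>The usual recurrence solved for its last term, so that \<open>bernoulli 1 = - 1 / 2\<close>.\<close>

fun bernoulli :: "nat \<Rightarrow> rat" where
  "bernoulli n = (if n = 0 then 1
     else - (\<Sum>k<n. of_nat ((n + 1) choose k) * bernoulli k) / of_nat (n + 1))"

declare bernoulli.simps [simp del]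

lemma bernoulli_0: "bernoulli 0 = 1"
  by (simp add: bernoulli.simps)

lemma bernoulli_recurrence:
  assumes "n \<ge> 2"
  shows "(\<Sum>k=0..n-1. of_nat (n choose k) * bernoulli k) = 0"
proof -
  obtain m where m: "n = Suc m" "m \<noteq> 0"
    using assms by (cases n) auto
  have "(\<Sum>k=0..n-1. of_nat (n choose k) * bernoulli k)
      = (\<Sum>k<m. of_nat (Suc m choose k) * bernoulli k) + of_nat (Suc m) * bernoulli m"
    using m(1) by (simp add: atLeast0AtMost lessThan_Suc_atMost[symmetric] del: of_nat_Suc)
  moreover have "of_nat (Suc m) * bernoulli m
      = - (\<Sum>k<m. of_nat (Suc m choose k) * bernoulli k)"
    using m(2) by (subst bernoulli.simps) (simp del: of_nat_Suc)
  ultimately show ?thesis by simp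
qed

definition bernpoly :: "nat \<Rightarrow> rat \<Rightarrow> rat" where
  "bernpoly n x = (\<Sum>k=0..n. of_nat (n choose k) * bernoulli k * x ^ (n - k))"

definition T :: "nat \<Rightarrow> rat \<Rightarrow> rat" where
  "T p x = (bernpoly (p\<^sup>2 * (p - 1)) (- x) - bernoulli (p\<^sup>2 * (p - 1))) / of_nat (p\<^sup>2 * (p - 1))"

end

theory Submission
  imports Defs "HOL-Number_Theory.Residues"
begin

text \<open>
  All quantities are polynomials in \<open>x\<close> with rational coefficients, so by density of the naturals
  in the \<open>p\<close>-adic integers it suffices to treat \<open>x = -1 - n\<close>. There \<open>T p x\<close> is a power sum, congruent
  modulo \<open>p ^ 3\<close> to the sum \<open>\<tau>\<close> of the inverses of the \<open>i \<le> n\<close> prime to \<open>p\<close>. With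
  \<open>h k z = (z choose k) (-1 - z choose k)\<close> one has \<open>V_p x = (\<Sum>k. h k p * h k n)\<close>, where
  \<open>h k p \<equiv> - p/k - p\<^sup>2/k\<^sup>2\<close> for \<open>0 < k < p\<close> and \<open>h p p \<equiv> -2\<close>. The sums \<open>\<Sum>k<p. h k n / k\<close> and
  \<open>\<Sum>k<p. h k n / k\<^sup>2\<close> are \<open>- 2 \<tau>\<close> modulo \<open>p\<^sup>2\<close> and \<open>- 2 \<tau>\<^sup>2\<close> modulo \<open>p\<close>, by induction on \<open>n\<close>: the
  differences in \<open>n\<close> are expressed by the partial products \<open>\<Prod>j. 1 - n\<^sup>2/j\<^sup>2\<close>, for which
  \<open>\<Sum>k. (n\<^sup>2/k\<^sup>2) (\<Prod>j<k. 1 - n\<^sup>2/j\<^sup>2)\<close> telescopes.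

  For the special values, \<open>1 + 2pT + 2p\<^sup>2T\<^sup>2\<close> behaves like \<open>exp (2pT)\<close> and is congruent to
  \<open>\<Prod>i. (i + p)/(i - p)\<close> over \<open>i \<le> n\<close> prime to \<open>p\<close>. This product telescopes, which gives
  \<open>(1 + 2pT + 2p\<^sup>2T\<^sup>2) y (y + 1) \<equiv> - h p z\<close> for \<open>x = -1 - z\<close> and \<open>z = r + p y\<close> with \<open>0 \<le> r < p\<close>. For
  \<open>z = - 1/2, - 2/3, - 3/4, - 5/6\<close> the right-hand side is a quotient of factorials of multiples
  of \<open>p\<close>, known modulo \<open>p ^ 3\<close>.
\<close>

section \<open>The \<open>p\<close>-integral rationals\<close>

text \<open>The reduced denominator divides every other denominator, so any representation with
  denominator prime to \<open>p\<close> may be used; closure under sums and products then needs no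
  reduction to lowest terms.\<close>

lemma mem_Zp_iff:
  assumes "prime p"
  shows "x \<in> Zp p \<longleftrightarrow> (\<exists>a b. \<not> int p dvd b \<and> x = of_int a / of_int b)"
proof
  assume x: "x \<in> Zp p"
  obtain a b where ab: "quotient_of x = (a, b)" by force
  have "coprime b (int p)" using x ab by (simp add: Zp_def)
  moreover have "prime (int p)" using assms by simp
  ultimately have "\<not> int p dvd b"
    by (metis coprime_absorb_right not_prime_unit)
  with quotient_of_div[OF ab] show "\<exists>a b. \<not> int p dvd b \<and> x = of_int a / of_int b"
    by blast
next
  assume "\<exists>a b. \<not> int p dvd b \<and> x = of_int a / of_int b"
  then obtain a b where b: "\<not> int p dvd b" and x: "x = of_int a / of_int b" by blast
  obtain c d where cd: "quotient_of x = (c, d)" by force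
  have d: "d > 0" using quotient_of_denom_pos[OF cd] .
  have b0: "b \<noteq> 0" using b by auto
  have "(of_int a / of_int b :: rat) = of_int c / of_int d"
    using quotient_of_div[OF cd] x by simp
  then have "(of_int (a * d) :: rat) = of_int (c * b)"
    using d b0 by (simp add: field_simps)
  then have eq: "a * d = c * b" by (simp only: of_int_eq_iff)
  have "coprime c d" using quotient_of_coprime[OF cd] .
  then have "d dvd b" using eq
    by (metis coprime_commute coprime_dvd_mult_right_iff dvd_triv_right)
  then have "\<not> int p dvd d" using b dvd_trans by blast
  then have "coprime d (int p)"
    using assms by (meson coprime_commute prime_imp_coprime prime_nat_int_transfer)
  with cd show "x \<in> Zp p" by (simp add: Zp_def)
qed

text \<open>Congruences modulo \<open>p ^ m\<close> are treated throughout as membership of a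
  difference in this ideal, so that exponents add under multiplication.\<close>

definition Zp_ideal :: "nat \<Rightarrow> nat \<Rightarrow> rat set" where
  "Zp_ideal p m = (\<lambda>c. of_nat p ^ m * c) ` Zp p"

section \<open>The local ring of \<open>p\<close>-integral rationals and its ideals\<close>

locale prime_gt_3 =
  fixes p :: nat
  assumes prime_p: "prime p" and p_gt_3: "p > 3"
begin

abbreviation Z :: "rat set" where "Z \<equiv> Zp p"
abbreviation I :: "nat \<Rightarrow> rat set" where "I \<equiv> Zp_ideal p"

lemma p_nonzero [simp]: "p \<noteq> 0"
  using p_gt_3 by simp

lemma Zp_of_int [simp]: "of_int a \<in> Z"
  unfolding mem_Zp_iff[OF prime_p]
  using prime_p by (intro exI[of _ a] exI[of _ 1]) (auto simp: not_prime_1)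

lemma Zp_of_nat [simp]: "of_nat n \<in> Z"
  using Zp_of_int[of "int n"] by simp

lemma Zp_numeral [simp]: "numeral n \<in> Z"
  using Zp_of_nat[of "numeral n"] by simp

lemma Zp_0 [simp]: "0 \<in> Z" and Zp_1 [simp]: "1 \<in> Z"
  using Zp_of_nat[of 0] Zp_of_nat[of 1] by simp_all

lemma Zp_add:
  assumes "x \<in> Z" "y \<in> Z"
  shows "x + y \<in> Z"
proof -
  obtain a b c d where *: "\<not> int p dvd b" "x = of_int a / of_int b"
    "\<not> int p dvd d" "y = of_int c / of_int d"
    using assms unfolding mem_Zp_iff[OF prime_p] by blast
  have "b \<noteq> 0" "d \<noteq> 0" using * by auto
  then have "x + y = of_int (a * d + c * b) / of_int (b * d)"
    using * by (simp add: field_simps)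
  moreover have "\<not> int p dvd b * d"
    using * prime_p by (simp add: prime_dvd_mult_iff)
  ultimately show ?thesis unfolding mem_Zp_iff[OF prime_p] by blast
qed

lemma Zp_mult:
  assumes "x \<in> Z" "y \<in> Z"
  shows "x * y \<in> Z"
proof -
  obtain a b c d where *: "\<not> int p dvd b" "x = of_int a / of_int b"
    "\<not> int p dvd d" "y = of_int c / of_int d"
    using assms unfolding mem_Zp_iff[OF prime_p] by blast
  then have "x * y = of_int (a * c) / of_int (b * d)" by simp
  moreover have "\<not> int p dvd b * d"
    using * prime_p by (simp add: prime_dvd_mult_iff)
  ultimately show ?thesis unfolding mem_Zp_iff[OF prime_p] by blast
qed

lemma Zp_uminus: "x \<in> Z \<Longrightarrow> - x \<in> Z"
  using Zp_mult[OF Zp_of_int[of "-1"], of x] by simp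

lemma Zp_diff: "x \<in> Z \<Longrightarrow> y \<in> Z \<Longrightarrow> x - y \<in> Z"
  using Zp_add[of x "- y"] Zp_uminus[of y] by simp

lemma Zp_power: "x \<in> Z \<Longrightarrow> x ^ n \<in> Z"
  by (induction n) (auto intro: Zp_mult)

lemma Zp_sum: "(\<And>i. i \<in> A \<Longrightarrow> f i \<in> Z) \<Longrightarrow> sum f A \<in> Z"
  by (induction A rule: infinite_finite_induct) (auto intro: Zp_add)

lemma Zp_prod: "(\<And>i. i \<in> A \<Longrightarrow> f i \<in> Z) \<Longrightarrow> prod f A \<in> Z"
  by (induction A rule: infinite_finite_induct) (auto intro: Zp_mult)

lemma mem_ideal_iff: "x \<in> I m \<longleftrightarrow> x / of_nat p ^ m \<in> Z"
  unfolding Zp_ideal_def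
  by (auto simp: image_iff intro!: bexI[of _ "x / of_nat p ^ m"])

lemma ideal_0 [simp]: "I 0 = Z"
  by (auto simp: mem_ideal_iff)

lemma ideal_zero [simp]: "0 \<in> I m"
  by (simp add: mem_ideal_iff)

lemma ideal_add: "x \<in> I m \<Longrightarrow> y \<in> I m \<Longrightarrow> x + y \<in> I m"
  by (simp add: mem_ideal_iff add_divide_distrib Zp_add)

lemma ideal_uminus: "x \<in> I m \<Longrightarrow> - x \<in> I m"
  using Zp_uminus by (fastforce simp add: mem_ideal_iff)

lemma ideal_diff: "x \<in> I m \<Longrightarrow> y \<in> I m \<Longrightarrow> x - y \<in> I m"
  by (simp add: mem_ideal_iff diff_divide_distrib Zp_diff)

lemma ideal_mult: "x \<in> I m \<Longrightarrow> y \<in> I n \<Longrightarrow> x * y \<in> I (m + n)"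
  using Zp_mult[of "x / of_nat p ^ m" "y / of_nat p ^ n"]
  by (simp add: mem_ideal_iff power_add)

lemma ideal_mult_1_1: "x \<in> I 1 \<Longrightarrow> y \<in> I 1 \<Longrightarrow> x * y \<in> I 2"
  and ideal_mult_1_2: "x \<in> I 1 \<Longrightarrow> y \<in> I 2 \<Longrightarrow> x * y \<in> I 3"
  and ideal_mult_2_1: "x \<in> I 2 \<Longrightarrow> y \<in> I 1 \<Longrightarrow> x * y \<in> I 3"
  using ideal_mult[of x 1 y 1] ideal_mult[of x 1 y 2] ideal_mult[of x 2 y 1]
  by (simp_all add: numeral_eq_Suc)

lemma ideal_mult_left: "x \<in> Z \<Longrightarrow> y \<in> I m \<Longrightarrow> x * y \<in> I m"
  using ideal_mult[of x 0 y m] by simp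

lemma ideal_mult_right: "x \<in> I m \<Longrightarrow> y \<in> Z \<Longrightarrow> x * y \<in> I m"
  using ideal_mult[of x m y 0] by simp

lemma ideal_sum: "(\<And>i. i \<in> A \<Longrightarrow> f i \<in> I m) \<Longrightarrow> sum f A \<in> I m"
  by (induction A rule: infinite_finite_induct) (auto intro: ideal_add)

lemma ideal_p_power: "of_nat p ^ m \<in> I m"
  by (simp add: mem_ideal_iff)

lemma ideal_antimono: "m \<le> n \<Longrightarrow> x \<in> I n \<Longrightarrow> x \<in> I m"
proof -
  assume "m \<le> n" "x \<in> I n"
  then have "of_nat p ^ (n - m) * (x / of_nat p ^ n) \<in> Z"
    by (intro Zp_mult Zp_power) (auto simp: mem_ideal_iff)
  moreover have "of_nat p ^ (n - m) * (x / of_nat p ^ n) = x / of_nat p ^ m"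
    using \<open>m \<le> n\<close> by (simp add: power_diff)
  ultimately show "x \<in> I m" by (simp add: mem_ideal_iff)
qed

lemma ideal_subset_Zp: "x \<in> I m \<Longrightarrow> x \<in> Z"
  using ideal_antimono[of 0 m x] by simp

lemma of_int_mem_ideal: "int p ^ m dvd a \<Longrightarrow> of_int a \<in> I m"
  by (elim dvdE) (simp add: mem_ideal_iff)

lemma of_nat_mem_ideal: "p ^ m dvd a \<Longrightarrow> of_nat a \<in> I m"
  by (elim dvdE) (simp add: mem_ideal_iff)

lemma Zp_inverse_of_int: "\<not> int p dvd b \<Longrightarrow> 1 / of_int b \<in> Z"
  unfolding mem_Zp_iff[OF prime_p] by (intro exI[of _ 1] exI[of _ b]) simp

lemma Zp_inverse_of_nat: "\<not> p dvd b \<Longrightarrow> 1 / of_nat b \<in> Z"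
  using Zp_inverse_of_int[of "int b"] by simp

text \<open>In a local ring everything outside the maximal ideal is a unit: here the numerator must
  be prime to \<open>p\<close>.\<close>

lemma Zp_inverse:
  assumes "x \<in> Z" "x \<notin> I 1"
  shows "1 / x \<in> Z"
proof -
  obtain a b where *: "\<not> int p dvd b" "x = of_int a / of_int b"
    using assms unfolding mem_Zp_iff[OF prime_p] by blast
  have "\<not> int p dvd a"
  proof
    assume "int p dvd a"
    then have "of_int a \<in> I 1" using of_int_mem_ideal[of 1 a] by simp
    from ideal_mult_right[OF this Zp_inverse_of_int[OF *(1)]] * assms(2)
    show False by simp
  qed
  then show ?thesis using * unfolding mem_Zp_iff[OF prime_p]
    by (intro exI[of _ b] exI[of _ a]) simp
qed

lemma ideal_cancel:
  assumes "1 / a \<in> Z" "a \<noteq> 0" "a * x \<in> I m"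
  shows "x \<in> I m"
  using ideal_mult_left[OF assms(1,3)] assms(2) by simp

lemma one_notin_ideal: "1 \<notin> I 1"
proof
  assume "1 \<in> I 1"
  then obtain a b where "\<not> int p dvd b" "1 / of_nat p = (of_int a / of_int b :: rat)"
    unfolding mem_ideal_iff mem_Zp_iff[OF prime_p] by auto
  then have "(of_int b :: rat) = of_int (int p * a)" by (auto simp: field_simps)
  then have "b = int p * a" by (simp only: of_int_eq_iff)
  with \<open>\<not> int p dvd b\<close> show False by simp
qed

text \<open>Polynomial functions with rational coefficients are Lipschitz in the \<open>p\<close>-adic metric; the
  denominators of the coefficients make the constant \<open>p ^ L\<close> necessary.\<close>

definition lip :: "(rat \<Rightarrow> rat) \<Rightarrow> bool" where
  "lip f \<longleftrightarrow> (\<exists>L. (\<forall>x\<in>Z. of_nat p ^ L * f x \<in> Z) \<and>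
     (\<forall>x\<in>Z. \<forall>y\<in>Z. \<exists>c\<in>Z. of_nat p ^ L * (f x - f y) = (x - y) * c))"

section \<open>Closure properties of \<open>p\<close>-adic Lipschitz functions\<close>

lemma lip_const: "lip (\<lambda>x. q)"
proof -
  obtain a b where ab: "quotient_of q = (a, b)" by force
  have b: "b > 0" using quotient_of_denom_pos[OF ab] .
  \<comment> \<open>Only the power of \<open>p\<close> in the denominator has to be cleared; the
    cofactor \<open>u\<close> is a unit.\<close>
  define v where "v = multiplicity (int p) b"
  obtain u where u: "b = int p ^ v * u" "\<not> int p dvd u"
    using multiplicity_decompose'[of b "int p"] b prime_p unfolding v_def
    by (metis less_irrefl not_prime_unit prime_nat_int_transfer)
  have "of_nat p ^ v * q = of_int a * (1 / of_int u)"
    using quotient_of_div[OF ab] u b by (simp add: field_simps)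
  then have "of_nat p ^ v * q \<in> Z"
    using Zp_mult[OF Zp_of_int Zp_inverse_of_int[OF u(2)]] by metis
  then show ?thesis unfolding lip_def
    by (intro exI[of _ v]) (auto intro: bexI[of _ 0])
qed

lemma lip_id: "lip (\<lambda>x. x)"
  unfolding lip_def by (intro exI[of _ 0]) (auto intro: bexI[of _ 1])

lemma lip_add:
  assumes "lip f" "lip g"
  shows "lip (\<lambda>x. f x + g x)"
proof -
  obtain L M where L: "\<forall>x\<in>Z. of_nat p ^ L * f x \<in> Z"
      "\<forall>x\<in>Z. \<forall>y\<in>Z. \<exists>c\<in>Z. of_nat p ^ L * (f x - f y) = (x - y) * c"
    and M: "\<forall>x\<in>Z. of_nat p ^ M * g x \<in> Z"
      "\<forall>x\<in>Z. \<forall>y\<in>Z. \<exists>c\<in>Z. of_nat p ^ M * (g x - g y) = (x - y) * c"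
    using assms unfolding lip_def by blast
  show ?thesis unfolding lip_def
  proof (intro exI[of _ "L + M"] conjI ballI)
    fix x assume "x \<in> Z"
    then have "of_nat p ^ L * f x \<in> Z" "of_nat p ^ M * g x \<in> Z" using L(1) M(1) by auto
    then have "of_nat p ^ M * (of_nat p ^ L * f x) + of_nat p ^ L * (of_nat p ^ M * g x) \<in> Z"
      by (meson Zp_add Zp_mult Zp_power Zp_of_nat)
    then show "of_nat p ^ (L + M) * (f x + g x) \<in> Z" by (simp add: power_add algebra_simps)
  next
    fix x y assume "x \<in> Z" "y \<in> Z"
    then obtain c d where *: "c \<in> Z" "of_nat p ^ L * (f x - f y) = (x - y) * c"
      "d \<in> Z" "of_nat p ^ M * (g x - g y) = (x - y) * d" using L(2) M(2) by blast
    have "of_nat p ^ (L + M) * (f x + g x - (f y + g y)) =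
       of_nat p ^ M * (of_nat p ^ L * (f x - f y)) + of_nat p ^ L * (of_nat p ^ M * (g x - g y))"
      by (simp add: power_add algebra_simps)
    also have "\<dots> = (x - y) * (of_nat p ^ M * c + of_nat p ^ L * d)"
      unfolding * by (simp add: algebra_simps)
    finally show "\<exists>c\<in>Z. of_nat p ^ (L + M) * (f x + g x - (f y + g y)) = (x - y) * c"
      using * by (intro bexI[of _ "of_nat p ^ M * c + of_nat p ^ L * d"] Zp_add Zp_mult Zp_power) auto
  qed
qed

lemma lip_mult:
  assumes "lip f" "lip g"
  shows "lip (\<lambda>x. f x * g x)"
proof -
  obtain L M where L: "\<forall>x\<in>Z. of_nat p ^ L * f x \<in> Z"
      "\<forall>x\<in>Z. \<forall>y\<in>Z. \<exists>c\<in>Z. of_nat p ^ L * (f x - f y) = (x - y) * c"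
    and M: "\<forall>x\<in>Z. of_nat p ^ M * g x \<in> Z"
      "\<forall>x\<in>Z. \<forall>y\<in>Z. \<exists>c\<in>Z. of_nat p ^ M * (g x - g y) = (x - y) * c"
    using assms unfolding lip_def by blast
  show ?thesis unfolding lip_def
  proof (intro exI[of _ "L + M"] conjI ballI)
    fix x assume "x \<in> Z"
    then have "of_nat p ^ L * f x \<in> Z" "of_nat p ^ M * g x \<in> Z" using L(1) M(1) by auto
    then have "(of_nat p ^ L * f x) * (of_nat p ^ M * g x) \<in> Z" by (rule Zp_mult)
    then show "of_nat p ^ (L + M) * (f x * g x) \<in> Z" by (simp add: power_add algebra_simps)
  next
    fix x y assume xy: "x \<in> Z" "y \<in> Z"
    then obtain c d where *: "c \<in> Z" "of_nat p ^ L * (f x - f y) = (x - y) * c"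
      "d \<in> Z" "of_nat p ^ M * (g x - g y) = (x - y) * d" using L(2) M(2) by blast
    have "of_nat p ^ (L + M) * (f x * g x - f y * g y) =
       (of_nat p ^ M * g x) * (of_nat p ^ L * (f x - f y)) +
       (of_nat p ^ L * f y) * (of_nat p ^ M * (g x - g y))"
      by (simp add: power_add algebra_simps)
    also have "\<dots> = (x - y) * ((of_nat p ^ M * g x) * c + (of_nat p ^ L * f y) * d)"
      unfolding * by (simp add: algebra_simps)
    finally have "of_nat p ^ (L + M) * (f x * g x - f y * g y) =
      (x - y) * ((of_nat p ^ M * g x) * c + (of_nat p ^ L * f y) * d)" .
    moreover have "(of_nat p ^ M * g x) * c + (of_nat p ^ L * f y) * d \<in> Z"
      using * xy L(1) M(1) by (meson Zp_add Zp_mult)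
    ultimately show "\<exists>c\<in>Z. of_nat p ^ (L + M) * (f x * g x - f y * g y) = (x - y) * c"
      by blast
  qed
qed

lemma lip_uminus: "lip f \<Longrightarrow> lip (\<lambda>x. - f x)"
  using lip_mult[OF lip_const[of "-1"]] by simp

lemma lip_diff: "lip f \<Longrightarrow> lip g \<Longrightarrow> lip (\<lambda>x. f x - g x)"
  using lip_add[OF _ lip_uminus] by simp

lemma lip_divide_const: "lip f \<Longrightarrow> lip (\<lambda>x. f x / q)"
  using lip_mult[OF _ lip_const[of "1 / q"]] by simp

lemma lip_power: "lip f \<Longrightarrow> lip (\<lambda>x. f x ^ n)"
  by (induction n) (auto intro: lip_const lip_mult)

lemma lip_sum: "(\<And>i. i \<in> A \<Longrightarrow> lip (f i)) \<Longrightarrow> lip (\<lambda>x. \<Sum>i\<in>A. f i x)"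
  by (induction A rule: infinite_finite_induct) (auto intro: lip_const lip_add)

lemma lip_prod: "(\<And>i. i \<in> A \<Longrightarrow> lip (f i)) \<Longrightarrow> lip (\<lambda>x. \<Prod>i\<in>A. f i x)"
  by (induction A rule: infinite_finite_induct) (auto intro: lip_const lip_mult)

lemma lip_gbinomial: "lip f \<Longrightarrow> lip (\<lambda>x. f x gchoose k)"
  unfolding gbinomial_prod_rev by (intro lip_divide_const lip_prod lip_diff lip_const)

lemmas lip_intros = lip_const lip_id lip_add lip_mult lip_uminus lip_diff lip_divide_const
  lip_power lip_sum lip_prod lip_gbinomial

text \<open>Inverting the denominator modulo \<open>p ^ m\<close> and reducing gives the
  approximating natural number.\<close>

lemma Zp_approx_nat:
  assumes "x \<in> Z"
  obtains n :: nat where "x - of_nat n \<in> I m"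
proof -
  obtain a b where *: "\<not> int p dvd b" "x = of_int a / of_int b"
    using assms unfolding mem_Zp_iff[OF prime_p] by blast
  have "coprime b (int p ^ m)"
    using *(1) prime_p by (meson coprime_commute coprime_power_right_iff prime_imp_coprime prime_nat_int_transfer)
  then obtain c where c: "[b * c = 1] (mod int p ^ m)"
    using cong_solve_coprime_int by blast
  define n where "n = nat (a * c mod int p ^ m)"
  have n: "int n = a * c mod int p ^ m" unfolding n_def using p_gt_3 by simp
  have "[b * int n = b * (a * c)] (mod int p ^ m)"
    unfolding n by (simp add: cong_def mod_mult_right_eq)
  also have "b * (a * c) = a * (b * c)" by simp
  also have "[a * (b * c) = a * 1] (mod int p ^ m)" using c by (rule cong_scalar_left)
  finally have "int p ^ m dvd a - b * int n"
    by (metis cong_iff_dvd_diff cong_sym mult.right_neutral)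
  then have "of_int (a - b * int n) \<in> I m" by (rule of_int_mem_ideal)
  from ideal_mult_right[OF this Zp_inverse_of_int[OF *(1)]]
  have "x - of_nat n \<in> I m" using * by (cases "b = 0") (auto simp: diff_divide_distrib)
  then show thesis by (rule that)
qed

text \<open>The Lipschitz estimate loses a factor \<open>p ^ L\<close>, so \<open>x\<close> is
  approximated modulo \<open>p ^ (m + L)\<close>.\<close>

lemma ideal_by_density:
  assumes f: "lip f" and nat: "\<And>n::nat. f (of_nat n) \<in> I m" and x: "x \<in> Z"
  shows "f x \<in> I m"
proof -
  obtain L where L: "\<forall>x\<in>Z. \<forall>y\<in>Z. \<exists>c\<in>Z. of_nat p ^ L * (f x - f y) = (x - y) * c"
    using f unfolding lip_def by blast
  obtain n :: nat where n: "x - of_nat n \<in> I (m + L)" using Zp_approx_nat[OF x] .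
  obtain c where c: "c \<in> Z" "of_nat p ^ L * (f x - f (of_nat n)) = (x - of_nat n) * c"
    using L x by (meson Zp_of_nat)
  have "of_nat p ^ L * (f x - f (of_nat n)) \<in> I (m + L)"
    unfolding c by (intro ideal_mult_right n c)
  then have "f x - f (of_nat n) \<in> I m" by (simp add: mem_ideal_iff power_add)
  from ideal_add[OF this nat[of n]] show ?thesis by simp
qed

text \<open>Binomial coefficients are integers at natural arguments; density with
  \<open>m = 0\<close> extends this to \<open>Z\<close>.\<close>

lemma Zp_gbinomial:
  assumes "x \<in> Z"
  shows "x gchoose k \<in> Z"
  using ideal_by_density[OF lip_gbinomial[OF lip_id], of k 0 x] assms
  by (simp add: binomial_gbinomial[symmetric])

end

section \<open>Binomial products, Bernoulli polynomials and power sums\<close>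

text \<open>This is \<open>h k z\<close> of the outline. It is invariant under \<open>z\<close> to
  \<open>-1 - z\<close>, so \<open>x\<close> and \<open>-1 - x\<close> are interchangeable in
  it.\<close>

definition binom_pair :: "nat \<Rightarrow> rat \<Rightarrow> rat" where
  "binom_pair k z = (z gchoose k) * ((-1 - z) gchoose k)"

text \<open>The truncated Euler product of \<open>sin (\<pi> x) / (\<pi> x)\<close>.\<close>

definition sine_prod :: "nat \<Rightarrow> rat \<Rightarrow> rat" where
  "sine_prod k x = (\<Prod>j=1..k. 1 - x\<^sup>2 / (of_nat j)\<^sup>2)"

section \<open>Factorisation of the binomial products\<close>

lemma gbinomial_Suc_rat: "(a::rat) gchoose Suc k = (a gchoose k) * (a - of_nat k) / of_nat (Suc k)"
  using gbinomial_mult_1[of a k] by (simp add: field_simps del: of_nat_Suc)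

lemma binom_pair_0 [simp]: "binom_pair 0 z = 1"
  by (simp add: binom_pair_def)

lemma binom_pair_Suc:
  "binom_pair (Suc k) z =
     binom_pair k z * ((z - of_nat k) * (-1 - z - of_nat k)) / (of_nat (Suc k))\<^sup>2"
  unfolding binom_pair_def gbinomial_Suc_rat by (simp add: power2_eq_square del: of_nat_Suc)

lemma binom_pair_zero: "k \<ge> 1 \<Longrightarrow> binom_pair k 0 = 0"
  by (simp add: binom_pair_def gbinomial_0_left)

lemma sine_prod_0 [simp]: "sine_prod 0 x = 1"
  by (simp add: sine_prod_def)

lemma sine_prod_Suc: "sine_prod (Suc k) x = sine_prod k x * (1 - x\<^sup>2 / (of_nat (Suc k))\<^sup>2)"
  by (simp add: sine_prod_def del: of_nat_Suc)

text \<open>The linear factors of the two binomials pair off as \<open>(x - j) (x + j)\<close> for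
  \<open>1 \<le> j \<le> k\<close>; only \<open>x\<close> and \<open>x + Suc k\<close> remain
  unpaired.\<close>

lemma binom_pair_Suc_eq_sine_prod:
  "binom_pair (Suc k) x = - x * (x + of_nat (Suc k)) / (of_nat (Suc k))\<^sup>2 * sine_prod k x"
proof (induction k)
  case 0
  show ?case by (simp add: binom_pair_Suc algebra_simps)
next
  case (Suc k)
  define m where "m = (of_nat (Suc k) :: rat)"
  have m: "m \<noteq> 0" "of_nat (Suc (Suc k)) = m + 1" "m + 1 \<noteq> 0"
    unfolding m_def by (simp_all del: of_nat_Suc add: of_nat_Suc[of "Suc k"] add_eq_0_iff)
  show ?case
    unfolding binom_pair_Suc[of "Suc k"] Suc.IH sine_prod_Suc m(2) unfolding m_def[symmetric]
    using m(1,3) by (simp add: divide_simps) (simp add: power2_eq_square algebra_simps)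
qed

lemma binom_pair_eq_sine_prod:
  assumes "k \<ge> 1"
  shows "binom_pair k x = - x * (x + of_nat k) / (of_nat k)\<^sup>2 * sine_prod (k - 1) x"
  using binom_pair_Suc_eq_sine_prod[of "k - 1" x] assms by simp

lemma binom_pair_diff_1_eq_sine_prod:
  assumes "k \<ge> 1"
  shows "binom_pair k (x - 1) = - x * (x - of_nat k) / (of_nat k)\<^sup>2 * sine_prod (k - 1) x"
proof -
  \<comment> \<open>Since \<open>-1 - (x - 1) = - x\<close>, the two binomial factors merely change
    places.\<close>
  have "binom_pair k (x - 1) = binom_pair k (- x)"
    by (simp add: binom_pair_def)
  also have "\<dots> = - (- x) * (- x + of_nat k) / (of_nat k)\<^sup>2 * sine_prod (k - 1) (- x)"
    by (rule binom_pair_eq_sine_prod[OF assms])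
  also have "sine_prod (k - 1) (- x) = sine_prod (k - 1) x"
    by (simp add: sine_prod_def)
  finally show ?thesis by (simp add: algebra_simps)
qed

text \<open>The values at \<open>x\<close> and \<open>x - 1\<close> share the even factor
  \<open>sine_prod (k - 1) x\<close>, so their difference and their sum are single terms. The
  difference drives the inductions on \<open>n\<close>, the sum links \<open>R\<close> to
  \<open>S\<close>.\<close>

lemma binom_pair_minus:
  assumes "k \<ge> 1"
  shows "binom_pair k x - binom_pair k (x - 1) = -2 * x * sine_prod (k - 1) x / of_nat k"
  unfolding binom_pair_diff_1_eq_sine_prod[OF assms] binom_pair_eq_sine_prod[OF assms, of x]
  using assms by (simp add: field_simps power2_eq_square)

lemma binom_pair_plus:
  assumes "k \<ge> 1"
  shows "binom_pair k x + binom_pair k (x - 1) = -2 * x\<^sup>2 * sine_prod (k - 1) x / (of_nat k)\<^sup>2"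
  unfolding binom_pair_diff_1_eq_sine_prod[OF assms] binom_pair_eq_sine_prod[OF assms, of x]
  using assms by (simp add: field_simps power2_eq_square)

text \<open>Each summand times \<open>x\<^sup>2\<close> is
  \<open>sine_prod (k - 1) x - sine_prod k x\<close>, so the sum telescopes.\<close>

lemma sum_sine_prod: "x\<^sup>2 * (\<Sum>k=1..m. sine_prod (k - 1) x / (of_nat k)\<^sup>2) = 1 - sine_prod m x"
  by (induction m) (simp_all add: sine_prod_Suc distrib_left right_diff_distrib del: of_nat_Suc)

text \<open>Negating the upper index absorbs the sign and \<open>(n + k) choose k\<close>, which
  makes the polynomial symmetric in \<open>n\<close> and \<open>z\<close>.\<close>

lemma V_poly_eq_binom_pair:
  "V_poly n (-1 - z) = (\<Sum>k=0..n. binom_pair k (of_nat n) * binom_pair k z)"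
proof -
  have "(-1 - of_nat n :: rat) gchoose k = (-1) ^ k * of_nat ((n + k) choose k)" for k
    using gbinomial_minus[of "1 + of_nat n :: rat" k]
    by (simp add: binomial_gbinomial algebra_simps)
  then show ?thesis unfolding V_poly_def binom_pair_def
    by (intro sum.cong) (simp_all add: binomial_gbinomial algebra_simps)
qed

section \<open>Bernoulli polynomials and their difference equation\<close>

lemma bernpoly_0_right: "bernpoly n 0 = bernoulli n"
proof -
  have "bernpoly n 0 = (\<Sum>k\<in>{n}. of_nat (n choose k) * bernoulli k * 0 ^ (n - k))"
    unfolding bernpoly_def by (intro sum.mono_neutral_right) auto
  then show ?thesis by simp
qed

text \<open>The recurrence starts only at 2. The extra 1 at \<open>n = 1\<close> is what produces
  the term \<open>n * x ^ (n - 1)\<close> in \<open>bernpoly_add_1\<close>.\<close>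

lemma bernoulli_binomial_sum:
  "(\<Sum>k=0..n. of_nat (n choose k) * bernoulli k) = bernoulli n + (if n = 1 then 1 else 0)"
proof -
  consider "n = 0" | "n = 1" | "n \<ge> 2" by linarith
  then show ?thesis
  proof cases
    case 3
    then obtain m where "n = Suc m" by (cases n) auto
    with bernoulli_recurrence[OF 3] 3 show ?thesis by simp
  qed (simp_all add: bernoulli_0)
qed

lemma bernpoly_altdef: "bernpoly n x = (\<Sum>j=0..n. of_nat (n choose j) * bernoulli (n - j) * x ^ j)"
  unfolding bernpoly_def
  by (subst sum.atLeastAtMost_rev)
    (auto intro!: sum.cong simp: binomial_symmetric[symmetric] simp flip: binomial_symmetric)

text \<open>Both sides count ordered pairs of disjoint subsets of sizes \<open>k\<close> and
  \<open>j\<close>.\<close>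

lemma binomial_mult_swap: "(n choose k) * ((n - k) choose j) = (n choose j) * ((n - j) choose k)"
proof (cases "k + j \<le> n")
  case True
  then show ?thesis
    using choose_mult[of k "k + j" n] choose_mult[of j "k + j" n] binomial_symmetric[of k "k + j"]
    by simp
next
  case False
  then have "(n choose k) * ((n - k) choose j) = 0" "(n choose j) * ((n - j) choose k) = 0"
    by (cases "n < k"; cases "n < j"; simp add: binomial_eq_0)+
  then show ?thesis by (simp only:)
qed

lemma bernpoly_add_1: "bernpoly n (x + 1) - bernpoly n x = of_nat n * x ^ (n - 1)"
proof -
  \<comment> \<open>Padding the inner sums with zero terms turns the triangle of indices into a
    square, where the sums can be swapped.\<close>
  have ext: "(\<Sum>k=0..n - j. of_nat ((n - j) choose k) * f k) =
      (\<Sum>k=0..n. of_nat ((n - j) choose k) * (f k :: rat))" for j f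
    by (intro sum.mono_neutral_left) (auto simp: binomial_eq_0)
  have "bernpoly n (x + 1) =
      (\<Sum>k=0..n. of_nat (n choose k) * bernoulli k * (\<Sum>j=0..n-k. of_nat ((n - k) choose j) * x ^ j))"
    unfolding bernpoly_def by (simp add: binomial_ring atLeast0AtMost)
  also have "\<dots> = (\<Sum>k=0..n. \<Sum>j=0..n. of_nat ((n choose k) * ((n - k) choose j)) * bernoulli k * x ^ j)"
    unfolding ext by (simp add: sum_distrib_left mult_ac)
  also have "\<dots> = (\<Sum>j=0..n. \<Sum>k=0..n. of_nat ((n choose j) * ((n - j) choose k)) * bernoulli k * x ^ j)"
    by (subst sum.swap) (simp only: binomial_mult_swap)
  also have "\<dots> = (\<Sum>j=0..n. of_nat (n choose j) * x ^ j * (\<Sum>k=0..n-j. of_nat ((n - j) choose k) * bernoulli k))"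
    unfolding ext by (simp add: sum_distrib_left mult_ac)
  also have "\<dots> = bernpoly n x + (\<Sum>j=0..n. if n - j = 1 then of_nat (n choose j) * x ^ j else 0)"
    unfolding bernoulli_binomial_sum bernpoly_altdef sum.distrib[symmetric]
    by (intro sum.cong) (auto simp: algebra_simps)
  also have "(\<Sum>j=0..n. if n - j = 1 then of_nat (n choose j) * x ^ j else 0) = of_nat n * x ^ (n - 1)"
  proof (cases n)
    case (Suc m)
    have "(\<Sum>j=0..n. if n - j = 1 then of_nat (n choose j) * x ^ j else 0) =
        (\<Sum>j\<in>{m}. of_nat (n choose j) * x ^ j)"
      by (intro sum.mono_neutral_cong_right) (auto simp: Suc)
    then show ?thesis by (simp add: Suc)
  qed simp
  finally show ?thesis by simp
qed

lemma bernpoly_diff_eq_power_sum: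
  assumes "n \<ge> 2"
  shows "bernpoly n (1 + of_nat m) - bernoulli n = of_nat n * (\<Sum>i=1..m. of_nat i ^ (n - 1))"
proof (induction m)
  case 0
  \<comment> \<open>The step from 0 to 1 adds \<open>n * 0 ^ (n - 1) = 0\<close> because
    \<open>n \<ge> 2\<close>; hence the power sum may start at 1.\<close>
  show ?case using bernpoly_add_1[of n 0] assms by (simp add: bernpoly_0_right)
next
  case (Suc m)
  show ?case
    using Suc.IH bernpoly_add_1[of n "1 + of_nat m"] by (simp add: algebra_simps)
qed

section \<open>Power sums as sums of inverses modulo \<open>p ^ 3\<close>\<close>

context prime_gt_3
begin

text \<open>The totient of \<open>p ^ 3\<close>, so Euler's theorem makes the exponent
  \<open>N - 1\<close> act as inversion on units.\<close>

definition N :: nat where "N = p\<^sup>2 * (p - 1)"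

text \<open>Modulo \<open>p ^ 3\<close> this is the inverse of \<open>i\<close>, or \<open>0\<close> if \<open>p\<close> divides \<open>i\<close>.\<close>

definition t :: "nat \<Rightarrow> rat" where "t i = of_nat i ^ (N - 1)"

definition tau :: "nat \<Rightarrow> rat" where "tau n = (\<Sum>i=1..n. t i)"

lemma N_ge_4: "N \<ge> 4"
proof -
  have "(2 * 2) * 1 \<le> (p * p) * (p - 1)" using p_gt_3 by (intro mult_le_mono) auto
  then show ?thesis by (simp add: N_def power2_eq_square)
qed

text \<open>The factor \<open>N\<close> of the power sum cancels exactly, so the powers of
  \<open>p\<close> in the denominator of \<open>T\<close> cost no precision.\<close>

lemma T_eq_tau: "T p (-1 - of_nat n) = tau n"
proof -
  have "T p (-1 - of_nat n) = (bernpoly N (1 + of_nat n) - bernoulli N) / of_nat N"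
    by (simp add: T_def N_def add.commute)
  then show ?thesis
    using bernpoly_diff_eq_power_sum[of N n] N_ge_4 by (simp add: tau_def t_def)
qed

lemma t_in_Zp [simp]: "t i \<in> Z" and tau_in_Zp [simp]: "tau n \<in> Z"
  by (auto simp: t_def tau_def intro!: Zp_power Zp_sum)

lemma tau_0 [simp]: "tau 0 = 0"
  by (simp add: tau_def)

lemma tau_Suc: "tau (Suc n) = tau n + t (Suc n)"
  by (simp add: tau_def)

lemma t_of_multiple:
  assumes "p dvd i"
  shows "t i \<in> I 3"
proof -
  have "p ^ 3 dvd p ^ (N - 1)" using N_ge_4 by (intro le_imp_power_dvd) simp
  also have "\<dots> dvd i ^ (N - 1)" using assms by (rule dvd_power_same)
  finally have "of_nat (i ^ (N - 1)) \<in> I 3" by (rule of_nat_mem_ideal)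
  then show ?thesis by (simp add: t_def)
qed

lemma t_of_unit:
  assumes "\<not> p dvd i"
  shows "of_nat i * t i - 1 \<in> I 3"
proof -
  have "coprime i (p ^ 3)"
    using assms prime_p by (meson coprime_commute coprime_power_right_iff prime_imp_coprime)
  from euler_theorem[OF this] have "[i ^ N = 1] (mod p ^ 3)"
    by (simp add: totient_prime_power prime_p N_def)
  then have "int p ^ 3 dvd int i ^ N - 1"
    by (metis cong_iff_dvd_diff cong_int_iff of_nat_1 of_nat_power)
  from of_int_mem_ideal[OF this] have "of_nat i ^ N - 1 \<in> I 3" by simp
  moreover have "of_nat i * t i = of_nat i ^ N"
    using N_ge_4 unfolding t_def by (metis not_numeral_le_zero power_eq_if)
  ultimately show ?thesis by simp
qed

lemma unit_below_p: "1 \<le> k \<Longrightarrow> k \<le> p - 1 \<Longrightarrow> \<not> p dvd k"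
  using p_gt_3 by (auto dest!: dvd_imp_le)

lemma Zp_divide_of_nat: "x \<in> Z \<Longrightarrow> \<not> p dvd k \<Longrightarrow> x / of_nat k \<in> Z"
  using Zp_mult[OF _ Zp_inverse_of_nat] by simp

lemma Zp_divide_of_nat_power: "x \<in> Z \<Longrightarrow> \<not> p dvd k \<Longrightarrow> x / of_nat k ^ m \<in> Z"
  using Zp_divide_of_nat[of x "k ^ m"] prime_dvd_power[OF prime_p, of k m] by auto

lemma ideal_divide_of_nat_power: "x \<in> I n \<Longrightarrow> \<not> p dvd k \<Longrightarrow> x / of_nat k ^ m \<in> I n"
  using ideal_mult_right[of x n, OF _ Zp_divide_of_nat_power[OF Zp_1, of k m]] by simp

lemma ideal_cancel_of_nat: "of_nat k * x \<in> I m \<Longrightarrow> \<not> p dvd k \<Longrightarrow> x \<in> I m"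
  by (rule ideal_cancel[OF Zp_inverse_of_nat]) (auto intro: Nat.gr0I)

text \<open>Doubling permutes the nonzero residues, so the sum is congruent to a quarter of itself;
  \<open>3/4\<close> is a unit because \<open>p > 3\<close>.\<close>

lemma sum_inverse_squares: "(\<Sum>k=1..p-1. 1 / (of_nat k)\<^sup>2) \<in> I 1"
proof -
  define f :: "nat \<Rightarrow> rat" where "f k = 1 / (of_nat k)\<^sup>2" for k
  define g where "g k = 2 * k mod p" for k
  have ndvd2: "\<not> p dvd 2" using p_gt_3 by (auto dest: dvd_imp_le)
  have g: "g k \<in> {1..p-1}" if "k \<in> {1..p-1}" for k
  proof -
    have "\<not> p dvd 2 * k"
      using unit_below_p[of k] that ndvd2 prime_p by (simp add: prime_dvd_mult_iff)
    then have "g k \<noteq> 0" by (simp add: g_def dvd_eq_mod_eq_0)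
    moreover have "g k < p" using p_gt_3 by (simp add: g_def)
    ultimately show ?thesis by simp
  qed
  have "inj_on g {1..p-1}"
  proof (rule inj_onI)
    fix x y assume xy: "x \<in> {1..p-1}" "y \<in> {1..p-1}" "g x = g y"
    then have "[2 * x = 2 * y] (mod p)" by (simp add: g_def cong_def)
    moreover have "coprime 2 p" using ndvd2 prime_p by (metis coprime_commute prime_imp_coprime)
    ultimately have "[x = y] (mod p)" by (simp add: cong_mult_lcancel_nat)
    then show "x = y" using xy by (auto simp: cong_def)
  qed
  then have "bij_betw g {1..p-1} {1..p-1}"
    using g by (metis bij_betw_def endo_inj_surj finite_atLeastAtMost image_subsetI)
  then have reindex: "(\<Sum>k=1..p-1. f k) = (\<Sum>k=1..p-1. f (g k))"
    by (rule sum.reindex_bij_betw[symmetric])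
  have "f (g k) - f k / 4 \<in> I 1" if k: "k \<in> {1..p-1}" for k
  proof -
    have units: "\<not> p dvd k" "\<not> p dvd g k" using k g[OF k] unit_below_p by auto
    then have nz: "k \<noteq> 0" "g k \<noteq> 0" by (metis dvd_0_right)+
    have "int p dvd (2 * int k) - int (g k)"
      unfolding g_def by (metis dvd_minus_mod of_nat_mod of_nat_mult of_nat_numeral)
    then have "int p ^ 1 dvd (2 * int k)\<^sup>2 - (int (g k))\<^sup>2"
      unfolding power2_eq_square square_diff_square_factored by (simp add: dvd_mult)
    from of_int_mem_ideal[OF this]
    have "(2 * of_nat k)\<^sup>2 - (of_nat (g k))\<^sup>2 \<in> I 1" by simp
    then have "((2 * of_nat k)\<^sup>2 - (of_nat (g k))\<^sup>2) / of_nat (g k) ^ 2 / of_nat k ^ 2 / of_nat 2 ^ 2 \<in> I 1"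
      using units ndvd2 by (intro ideal_divide_of_nat_power)
    moreover have "((2 * of_nat k)\<^sup>2 - (of_nat (g k))\<^sup>2) / of_nat (g k) ^ 2 / of_nat k ^ 2 / of_nat 2 ^ 2 = f (g k) - f k / 4"
      using nz by (simp add: f_def field_simps)
    ultimately show ?thesis by simp
  qed
  then have "(\<Sum>k=1..p-1. f (g k) - f k / 4) \<in> I 1" by (rule ideal_sum)
  also have "(\<Sum>k=1..p-1. f (g k) - f k / 4) = 3 / 4 * (\<Sum>k=1..p-1. f k)"
    unfolding sum_subtractf reindex[symmetric] sum_divide_distrib[symmetric] by simp
  finally have "3 / 4 * (\<Sum>k=1..p-1. f k) \<in> I 1" .
  from ideal_mult_left[OF Zp_of_nat[of 4] this]
  have "of_nat 3 * (\<Sum>k=1..p-1. f k) \<in> I 1" by (simp only: of_nat_numeral) simp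
  moreover have "\<not> p dvd 3" using p_gt_3 by (auto dest: dvd_imp_le)
  ultimately show ?thesis unfolding f_def by (rule ideal_cancel_of_nat)
qed

end

section \<open>The general congruence\<close>

context prime_gt_3
begin

lemma ideal_prod:
  assumes "finite A" "j \<in> A" "f j \<in> I m" "\<And>i. i \<in> A \<Longrightarrow> f i \<in> Z"
  shows "prod f A \<in> I m"
proof -
  have "prod f A = f j * prod f (A - {j})" using assms by (intro prod.remove)
  moreover have "prod f (A - {j}) \<in> Z" using assms by (intro Zp_prod) auto
  ultimately show ?thesis using ideal_mult_right[OF assms(3)] by simp
qed

lemma sine_prod_in_Zp:
  assumes "m < p" "x \<in> Z"
  shows "sine_prod m x \<in> Z"
  unfolding sine_prod_def
  by (intro Zp_prod Zp_diff Zp_1 Zp_divide_of_nat_power Zp_power assms(2) unit_below_p)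
    (use assms(1) in auto)

text \<open>Each factor splits as \<open>(1 - n/j) (1 + n/j)\<close>. One multiple of
  \<open>p\<close> comes from \<open>j = r\<close>, the residue of \<open>n\<close>, the other from
  \<open>j = p - r\<close>.\<close>

lemma sine_prod_of_unit:
  assumes "\<not> p dvd n"
  shows "sine_prod (p - 1) (of_nat n) \<in> I 2"
proof -
  define r where "r = n mod p"
  have r: "1 \<le> r" "r \<le> p - 1"
  proof -
    have "r < p" "r \<noteq> 0" using assms p_gt_3 by (auto simp: r_def dvd_eq_mod_eq_0)
    then show "1 \<le> r" "r \<le> p - 1" by auto
  qed
  have prods: "(\<Prod>j=1..p-1. 1 + c * of_nat n / of_nat j) \<in> I 1"
    if "c \<in> Z" "i \<in> {1..p-1}" "of_nat i + c * of_nat n \<in> I 1" for c i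
  proof (rule ideal_prod[of _ i])
    have i: "\<not> p dvd i" "i \<noteq> 0" using that(2) unit_below_p by auto
    from ideal_divide_of_nat_power[OF that(3) i(1), of 1] i(2)
    show "1 + c * of_nat n / of_nat i \<in> I 1" by (simp add: add_divide_distrib)
    fix j assume "j \<in> {1..p-1}"
    then show "1 + c * of_nat n / of_nat j \<in> Z"
      using that(1) unit_below_p[of j]
      by (intro Zp_add Zp_1 Zp_divide_of_nat Zp_mult Zp_of_nat) auto
  qed (use that in auto)
  have "int p dvd int r - int n"
    unfolding r_def by (metis dvd_minus_mod of_nat_mod dvd_diff_commute)
  then have a: "of_nat r - of_nat n \<in> I 1" using of_int_mem_ideal[of 1 "int r - int n"] by simp
  have b: "of_nat (p - r) + of_nat n \<in> I 1"
  proof -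
    have "of_nat p - (of_nat r - of_nat n) \<in> I 1"
      using ideal_diff[OF ideal_p_power[of 1] a] by simp
    then show ?thesis using r p_gt_3 by (simp add: of_nat_diff diff_diff_eq2 diff_add_eq)
  qed
  have "(\<Prod>j=1..p-1. 1 - of_nat n / of_nat j) \<in> I 1"
    using prods[of "-1" r] a r Zp_uminus[OF Zp_1] by simp
  moreover have "(\<Prod>j=1..p-1. 1 + of_nat n / of_nat j) \<in> I 1"
  proof -
    have "p - r \<in> {1..p-1}" using r p_gt_3 by auto
    then show ?thesis using prods[of 1 "p - r"] b by simp
  qed
  moreover have "sine_prod (p - 1) (of_nat n) =
      (\<Prod>j=1..p-1. 1 - of_nat n / of_nat j) * (\<Prod>j=1..p-1. 1 + of_nat n / of_nat j)"
    unfolding sine_prod_def prod.distrib[symmetric]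
    by (intro prod.cong) (simp_all add: algebra_simps power2_eq_square)
  ultimately show ?thesis by (simp only: ideal_mult_1_1)
qed

lemma sine_prod_of_multiple:
  assumes "x \<in> I 1" "m < p"
  shows "sine_prod m x - 1 \<in> I 2"
  using assms(2)
proof (induction m)
  case (Suc m)
  have "x\<^sup>2 \<in> I 2" using ideal_mult_1_1[OF assms(1,1)] by (simp add: power2_eq_square)
  then have "sine_prod m x * x\<^sup>2 / of_nat (Suc m) ^ 2 \<in> I 2"
    using Suc.prems unit_below_p[of "Suc m"] sine_prod_in_Zp ideal_subset_Zp[OF assms(1)]
    by (intro ideal_divide_of_nat_power ideal_mult_left) auto
  from ideal_diff[OF Suc.IH this] Suc.prems show ?case
    by (simp add: sine_prod_Suc algebra_simps)
qed simp

section \<open>The two weighted sums of binomial products\<close>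

text \<open>Replacing \<open>binom_pair k p\<close> by \<open>- p/k - p^2/k^2\<close> for
  \<open>0 < k < p\<close> turns the middle part of \<open>V_p\<close> into
  \<open>- p * S - p^2 * R\<close>.\<close>

definition S :: "rat \<Rightarrow> rat" where "S x = (\<Sum>k=1..p-1. binom_pair k x / of_nat k)"
definition R :: "rat \<Rightarrow> rat" where "R x = (\<Sum>k=1..p-1. binom_pair k x / (of_nat k)\<^sup>2)"

lemma S_diff: "S x - S (x - 1) = -2 * x * (\<Sum>k=1..p-1. sine_prod (k - 1) x / (of_nat k)\<^sup>2)"
  unfolding S_def sum_subtractf[symmetric] sum_distrib_left diff_divide_distrib[symmetric]
  by (intro sum.cong refl) (subst binom_pair_minus; simp add: power2_eq_square)

lemma R_diff: "R x - R (x - 1) = -2 * x * (\<Sum>k=1..p-1. sine_prod (k - 1) x / (of_nat k) ^ 3)"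
  unfolding R_def sum_subtractf[symmetric] sum_distrib_left diff_divide_distrib[symmetric]
  by (intro sum.cong refl) (subst binom_pair_minus; simp add: eval_nat_numeral)

text \<open>Multiplying the difference term by \<open>x/k\<close> gives the sum term, so the
  induction for \<open>R\<close> can feed on the congruence for \<open>S\<close>.\<close>

lemma R_diff_eq_S_sum: "x * (R x - R (x - 1)) = S x + S (x - 1)"
  unfolding R_def S_def sum_subtractf[symmetric] sum.distrib[symmetric] sum_distrib_left
    diff_divide_distrib[symmetric] add_divide_distrib[symmetric]
  by (intro sum.cong refl) (subst binom_pair_minus binom_pair_plus; simp add: power2_eq_square mult_ac)+

lemma S_cong: "S (of_nat n) + 2 * tau n \<in> I 2"
proof (induction n)
  case 0
  show ?case by (simp add: S_def binom_pair_zero)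
next
  case (Suc n)
  define x where "x = (of_nat (Suc n) :: rat)"
  have x: "x - 1 = of_nat n" by (simp add: x_def)
  have "S x - S (x - 1) + 2 * t (Suc n) \<in> I 2"
  proof (cases "p dvd Suc n")
    case True
    \<comment> \<open>One factor \<open>p\<close> is \<open>x\<close> itself. The other comes from
      the sum, where each \<open>sine_prod (k - 1) x\<close> may be replaced by 1, leaving the
      inverse squares.\<close>
    then have xI: "x \<in> I 1" using of_nat_mem_ideal[of 1 "Suc n"] by (simp add: x_def)
    have "(\<Sum>k=1..p-1. (sine_prod (k - 1) x - 1) / (of_nat k)\<^sup>2) \<in> I 1"
      by (intro ideal_sum ideal_divide_of_nat_power unit_below_p
          ideal_antimono[OF _ sine_prod_of_multiple[OF xI]]) auto
    from ideal_add[OF this sum_inverse_squares]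
    have "(\<Sum>k=1..p-1. sine_prod (k - 1) x / (of_nat k)\<^sup>2) \<in> I 1"
      by (simp add: diff_divide_distrib sum_subtractf)
    from ideal_mult_left[OF Zp_of_int[of "-2"] ideal_mult_1_1[OF xI this]]
    have "S x - S (x - 1) \<in> I 2" unfolding S_diff by (simp add: mult.assoc)
    moreover have "2 * t (Suc n) \<in> I 2"
      using True by (intro ideal_mult_left ideal_antimono[OF _ t_of_multiple]) auto
    ultimately show ?thesis by (rule ideal_add)
  next
    case False
    \<comment> \<open>After multiplication by the unit \<open>x\<close> the sum telescopes, and its
      end term \<open>sine_prod (p - 1) x\<close> vanishes modulo \<open>p\<^sup>2\<close>.\<close>
    have "x * (S x - S (x - 1)) =
        -2 * (x\<^sup>2 * (\<Sum>k=1..p-1. sine_prod (k - 1) x / (of_nat k)\<^sup>2))"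
      unfolding S_diff by (simp add: power2_eq_square)
    also have "\<dots> = -2 * (1 - sine_prod (p - 1) x)" unfolding sum_sine_prod ..
    finally have "x * (S x - S (x - 1) + 2 * t (Suc n)) =
        2 * sine_prod (p - 1) x + 2 * (x * t (Suc n) - 1)"
      by (simp add: algebra_simps)
    also have "\<dots> \<in> I 2"
      using sine_prod_of_unit[OF False] ideal_antimono[OF _ t_of_unit[OF False], of 2]
      by (intro ideal_add ideal_mult_left) (auto simp: x_def)
    finally show ?thesis using False unfolding x_def by (rule ideal_cancel_of_nat)
  qed
  from ideal_add[OF Suc.IH this] show ?case
    unfolding x x_def[symmetric] tau_Suc by (simp add: algebra_simps)
qed

lemma R_cong: "R (of_nat n) + 2 * (tau n)\<^sup>2 \<in> I 1"
proof (induction n)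
  case 0
  show ?case by (simp add: R_def binom_pair_zero)
next
  case (Suc n)
  define x where "x = (of_nat (Suc n) :: rat)"
  have x: "x - 1 = of_nat n" by (simp add: x_def)
  \<comment> \<open>The last product is the increment of \<open>2 * tau\<^sup>2\<close>, factored as
    a difference of squares.\<close>
  have "R x - R (x - 1) + 2 * t (Suc n) * (tau n + tau (Suc n)) \<in> I 1"
  proof (cases "p dvd Suc n")
    case True
    then have xI: "x \<in> I 1" using of_nat_mem_ideal[of 1 "Suc n"] by (simp add: x_def)
    have "(\<Sum>k=1..p-1. sine_prod (k - 1) x / (of_nat k) ^ 3) \<in> Z"
      using ideal_subset_Zp[OF xI]
      by (intro Zp_sum Zp_divide_of_nat_power unit_below_p sine_prod_in_Zp) auto
    then have "R x - R (x - 1) \<in> I 1"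
      unfolding R_diff using xI Zp_of_int[of "-2"] by (intro ideal_mult_right ideal_mult_left) auto
    moreover have "2 * t (Suc n) * (tau n + tau (Suc n)) \<in> I 1"
      using True
      by (intro ideal_mult_right ideal_mult_left ideal_antimono[OF _ t_of_multiple] Zp_add) auto
    ultimately show ?thesis by (rule ideal_add)
  next
    case False
    have S: "S x + 2 * tau (Suc n) \<in> I 1" "S (x - 1) + 2 * tau n \<in> I 1"
      unfolding x unfolding x_def by (rule ideal_antimono[OF _ S_cong], simp)+
    have "x * (R x - R (x - 1) + 2 * t (Suc n) * (tau n + tau (Suc n))) =
        x * (R x - R (x - 1)) + 2 * (x * t (Suc n)) * (tau n + tau (Suc n))"
      by (simp add: algebra_simps)
    also have "\<dots> = (S x + 2 * tau (Suc n)) + (S (x - 1) + 2 * tau n)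
        + 2 * (tau n + tau (Suc n)) * (x * t (Suc n) - 1)"
      unfolding R_diff_eq_S_sum by (simp add: algebra_simps)
    also have "\<dots> \<in> I 1"
    proof (intro ideal_add[OF ideal_add[OF S]] ideal_mult_left)
      show "x * t (Suc n) - 1 \<in> I 1"
        unfolding x_def by (rule ideal_antimono[OF _ t_of_unit[OF False]]) simp
    qed (auto intro!: Zp_mult Zp_add)
    finally show ?thesis using False unfolding x_def by (rule ideal_cancel_of_nat)
  qed
  from ideal_add[OF Suc.IH this] show ?case
    unfolding x x_def[symmetric] tau_Suc by (simp add: algebra_simps power2_eq_square)
qed

lemma binom_pair_p_p: "binom_pair p (of_nat p) = -2 * sine_prod (p - 1) (of_nat p)"
  using binom_pair_eq_sine_prod[of p "of_nat p"] p_gt_3 by (simp add: power2_eq_square)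

text \<open>Products of two or more of the \<open>a i\<close> already lie in
  \<open>I 4\<close>.\<close>

lemma prod_one_plus_cong:
  assumes "\<And>i. i \<in> A \<Longrightarrow> a i \<in> I 2"
  shows "(\<Prod>i\<in>A. 1 + a i) - (1 + (\<Sum>i\<in>A. a i)) \<in> I 3"
  using assms
proof (induction A rule: infinite_finite_induct)
  case (insert i A)
  have "(\<Sum>i\<in>A. a i) \<in> I 2" using insert by (intro ideal_sum) auto
  then have "a i * (\<Sum>i\<in>A. a i) \<in> I (2 + 2)" using insert by (intro ideal_mult) auto
  then have "a i * (\<Sum>i\<in>A. a i) \<in> I 3" by (rule ideal_antimono[rotated]) simp
  moreover have "(1 + a i) * ((\<Prod>i\<in>A. 1 + a i) - (1 + (\<Sum>i\<in>A. a i))) \<in> I 3"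
    using insert by (intro ideal_mult_left Zp_add) (auto intro: ideal_subset_Zp)
  ultimately have "a i * (\<Sum>i\<in>A. a i) + (1 + a i) * ((\<Prod>i\<in>A. 1 + a i) - (1 + (\<Sum>i\<in>A. a i))) \<in> I 3"
    by (rule ideal_add)
  then show ?case using insert by (simp add: algebra_simps)
qed simp_all

text \<open>This is Wolstenholme's congruence: \<open>2 * sine_prod (p - 1) p\<close> is the central binomial
  coefficient.\<close>

lemma sine_prod_p: "sine_prod (p - 1) (of_nat p) - 1 \<in> I 3"
proof -
  have p2: "(of_nat p)\<^sup>2 \<in> I 2" by (rule ideal_p_power)
  have "(\<Prod>j=1..p-1. 1 + - (of_nat p)\<^sup>2 / (of_nat j)\<^sup>2) - (1 + (\<Sum>j=1..p-1. - (of_nat p)\<^sup>2 / (of_nat j)\<^sup>2)) \<in> I 3"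
    by (intro prod_one_plus_cong ideal_divide_of_nat_power ideal_uminus p2 unit_below_p) auto
  moreover have "(\<Sum>j=1..p-1. - (of_nat p)\<^sup>2 / (of_nat j)\<^sup>2) \<in> I 3"
    using ideal_uminus[OF ideal_mult_2_1[OF p2 sum_inverse_squares]] by (simp add: sum_distrib_left sum_negf)
  ultimately have "(\<Prod>j=1..p-1. 1 + - (of_nat p)\<^sup>2 / (of_nat j)\<^sup>2) - 1 \<in> I 3"
    using ideal_add by fastforce
  then show ?thesis by (simp add: sine_prod_def)
qed

lemma V_poly_cong_nat:
  "V_poly p (-1 - of_nat n) - (1 - 2 * binom_pair p (of_nat n) + 2 * of_nat p * tau n
     + 2 * of_nat p ^ 2 * (tau n) ^ 2) \<in> I 3"
proof -
  define P where "P = (of_nat p :: rat)"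
  have pI: "P ^ m \<in> I m" for m unfolding P_def by (rule ideal_p_power)
  have P1: "P \<in> I 1" using pI[of 1] by simp
  have bpZ: "binom_pair k (of_nat n) \<in> Z" for k
    unfolding binom_pair_def by (intro Zp_mult Zp_gbinomial Zp_diff Zp_uminus) auto
  have split: "{0..p} = insert 0 (insert p {1..p-1})" using p_gt_3 by auto
  have V: "V_poly p (-1 - of_nat n) =
      1 + (binom_pair p P * binom_pair p (of_nat n)
        + (\<Sum>k=1..p-1. binom_pair k P * binom_pair k (of_nat n)))"
    unfolding V_poly_eq_binom_pair split P_def using p_gt_3 by (subst sum.insert; simp)+
  \<comment> \<open>Wolstenholme's congruence replaces the factor \<open>binom_pair p p\<close> by
    -2.\<close>
  have pp: "(binom_pair p P + 2) * binom_pair p (of_nat n) \<in> I 3"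
  proof -
    have "binom_pair p P + 2 = of_int (-2) * (sine_prod (p - 1) P - 1)"
      unfolding P_def binom_pair_p_p by simp
    also have "\<dots> \<in> I 3" unfolding P_def by (intro ideal_mult_left sine_prod_p Zp_of_int)
    finally show ?thesis by (intro ideal_mult_right bpZ)
  qed
  \<comment> \<open>In the product formula \<open>sine_prod (k - 1) P\<close> is 1 modulo
    \<open>p\<^sup>2\<close>, and the prefactor \<open>P\<close> raises this to
    \<open>p ^ 3\<close>.\<close>
  have mid: "(\<Sum>k=1..p-1. (binom_pair k P + (P / of_nat k + P\<^sup>2 / (of_nat k)\<^sup>2)) * binom_pair k (of_nat n)) \<in> I 3"
  proof (intro ideal_sum ideal_mult_right bpZ)
    fix k assume k: "k \<in> {1..p-1}"
    then have u: "\<not> p dvd k" "k \<ge> 1" using unit_below_p by auto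
    have "sine_prod (k - 1) P - 1 \<in> I 2"
      using k p_gt_3 by (intro sine_prod_of_multiple P1) auto
    from ideal_mult_1_2[OF P1 this] have "P * (sine_prod (k - 1) P - 1) \<in> I 3" .
    then have "(P + of_nat k) * (P * (sine_prod (k - 1) P - 1)) \<in> I 3"
      by (rule ideal_mult_left[OF Zp_add[OF ideal_subset_Zp[OF P1] Zp_of_nat]])
    then have "- ((P + of_nat k) * (P * (sine_prod (k - 1) P - 1)) / of_nat k ^ 2) \<in> I 3"
      using u by (intro ideal_uminus ideal_divide_of_nat_power)
    also have "- ((P + of_nat k) * (P * (sine_prod (k - 1) P - 1)) / of_nat k ^ 2) =
        binom_pair k P + (P / of_nat k + P\<^sup>2 / (of_nat k)\<^sup>2)"
      using u(2) by (simp add: binom_pair_eq_sine_prod field_simps power2_eq_square)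
    finally show "binom_pair k P + (P / of_nat k + P\<^sup>2 / (of_nat k)\<^sup>2) \<in> I 3" .
  qed
  have split_mid: "(\<Sum>k=1..p-1. (binom_pair k P + (P / of_nat k + P\<^sup>2 / (of_nat k)\<^sup>2)) * binom_pair k (of_nat n)) =
      (\<Sum>k=1..p-1. binom_pair k P * binom_pair k (of_nat n)) + P * S (of_nat n) + P\<^sup>2 * R (of_nat n)"
    unfolding S_def R_def sum_distrib_left sum.distrib[symmetric]
    by (intro sum.cong) (auto simp: algebra_simps)
  \<comment> \<open>The factors \<open>P\<close> and \<open>P\<^sup>2\<close> raise the congruences
    for \<open>S\<close> and \<open>R\<close> to modulus \<open>p ^ 3\<close>.\<close>
  have Sc: "P * (S (of_nat n) + 2 * tau n) \<in> I 3"
    using ideal_mult_1_2[OF P1 S_cong] .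
  have Rc: "P\<^sup>2 * (R (of_nat n) + 2 * (tau n)\<^sup>2) \<in> I 3"
    using ideal_mult_2_1[OF pI R_cong] .
  define B U M where "B = binom_pair p (of_nat n)" and "U = tau n"
    and "M = (\<Sum>k=1..p-1. binom_pair k P * binom_pair k (of_nat n))"
  have "V_poly p (-1 - of_nat n) - (1 - 2 * B + 2 * P * U + 2 * P\<^sup>2 * U\<^sup>2) =
      (binom_pair p P + 2) * B + (M + P * S (of_nat n) + P\<^sup>2 * R (of_nat n))
       - P * (S (of_nat n) + 2 * U) - P\<^sup>2 * (R (of_nat n) + 2 * U\<^sup>2)"
    unfolding V B_def[symmetric] M_def[symmetric] by (simp add: algebra_simps)
  also have "\<dots> \<in> I 3"
    using pp mid Sc Rc unfolding split_mid B_def[symmetric] M_def[symmetric] U_def[symmetric]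
    by (intro ideal_diff[OF ideal_diff[OF ideal_add]])
  finally show ?thesis unfolding P_def B_def U_def .
qed

section \<open>Extension from natural numbers to all of \<open>Z\<close>\<close>

lemma lip_T: "lip f \<Longrightarrow> lip (\<lambda>z. T p (f z))"
  unfolding T_def bernpoly_def by (intro lip_intros)

lemma lip_V_poly: "lip f \<Longrightarrow> lip (\<lambda>z. V_poly p (f z))"
  unfolding V_poly_def by (intro lip_intros)

lemma lip_binom_pair: "lip f \<Longrightarrow> lip (\<lambda>z. binom_pair k (f z))"
  unfolding binom_pair_def by (intro lip_intros)

definition E :: "rat \<Rightarrow> rat" where
  "E x = 1 + 2 * of_nat p * T p x + 2 * of_nat p ^ 2 * (T p x) ^ 2"

lemma lip_E: "lip f \<Longrightarrow> lip (\<lambda>z. E (f z))"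
  unfolding E_def by (intro lip_intros lip_T)

lemma V_poly_cong:
  assumes "z \<in> Z"
  shows "V_poly p (-1 - z) - (E (-1 - z) - 2 * binom_pair p z) \<in> I 3"
proof (rule ideal_by_density[OF _ _ assms])
  show "lip (\<lambda>z. V_poly p (-1 - z) - (E (-1 - z) - 2 * binom_pair p z))"
    by (intro lip_intros lip_V_poly lip_E lip_binom_pair)
  show "V_poly p (-1 - of_nat n) - (E (-1 - of_nat n) - 2 * binom_pair p (of_nat n)) \<in> I 3" for n
    using V_poly_cong_nat[of n] by (simp add: E_def T_eq_tau algebra_simps)
qed

lemma V_poly_in_Zp: "x \<in> Z \<Longrightarrow> V_poly p x \<in> Z"
  unfolding V_poly_def
  by (intro Zp_sum Zp_mult Zp_power Zp_gbinomial Zp_diff Zp_uminus Zp_of_nat Zp_1) auto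

lemma binom_pair_in_Zp: "x \<in> Z \<Longrightarrow> binom_pair k x \<in> Z"
  unfolding binom_pair_def
  by (intro Zp_mult Zp_gbinomial Zp_diff Zp_uminus Zp_1) auto

lemma Zp_congI:
  assumes "a - b \<in> I m" "a \<in> Z"
  shows "Zp_cong p m a b"
proof -
  have "b = a - (a - b)" by simp
  then have "b \<in> Z" using assms by (metis Zp_diff ideal_subset_Zp)
  then show ?thesis using assms unfolding Zp_cong_def Zp_ideal_def by auto
qed

lemma V_poly_Zp_cong:
  assumes "x \<in> Z"
  shows "Zp_cong p 3 (V_poly p x)
            (1 - 2 * (x gchoose p) * ((-1 - x) gchoose p)
               + 2 * of_nat p * T p x + 2 * of_nat p ^ 2 * (T p x) ^ 2)"
proof (rule Zp_congI)
  have "-1 - x \<in> Z" using assms by (intro Zp_diff Zp_uminus Zp_1)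
  from V_poly_cong[OF this]
  show "V_poly p x - (1 - 2 * (x gchoose p) * ((-1 - x) gchoose p)
      + 2 * of_nat p * T p x + 2 * of_nat p ^ 2 * (T p x) ^ 2) \<in> I 3"
    by (simp add: E_def binom_pair_def algebra_simps)
qed (rule V_poly_in_Zp[OF assms])

end

section \<open>The special values\<close>

lemma fact_add_rat: "(fact (n + k) :: rat) = fact n * (\<Prod>i=1..k. of_nat n + of_nat i)"
  by (induction k) (simp_all add: algebra_simps)

lemma binom_pair_neg_half: "16 ^ n * binom_pair n (-1/2) * (fact n) ^ 4 = (fact (2 * n))\<^sup>2"
proof (induction n)
  case (Suc n)
  have "16 ^ Suc n * binom_pair (Suc n) (-1/2) * (fact (Suc n)) ^ 4 =
      (16 ^ n * binom_pair n (-1/2) * (fact n) ^ 4) * ((2 * of_nat n + 1)\<^sup>2 * (2 * of_nat n + 2)\<^sup>2)"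
    by (simp add: binom_pair_Suc divide_simps del: of_nat_Suc)
       (simp add: algebra_simps eval_nat_numeral)
  also have "\<dots> = (fact (2 * Suc n))\<^sup>2"
    unfolding Suc.IH by (simp add: power_mult_distrib algebra_simps eval_nat_numeral)
  finally show ?case .
qed simp

lemma binom_pair_neg_two_thirds: "27 ^ n * binom_pair n (-2/3) * (fact n) ^ 3 = fact (3 * n)"
proof (induction n)
  case (Suc n)
  have "27 ^ Suc n * binom_pair (Suc n) (-2/3) * (fact (Suc n)) ^ 3 =
      (27 ^ n * binom_pair n (-2/3) * (fact n) ^ 3)
        * ((3 * of_nat n + 1) * (3 * of_nat n + 2) * (3 * of_nat n + 3))"
    by (simp add: binom_pair_Suc divide_simps del: of_nat_Suc)
       (simp add: algebra_simps eval_nat_numeral)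
  also have "\<dots> = fact (3 * Suc n)"
    unfolding Suc.IH by (simp add: algebra_simps eval_nat_numeral)
  finally show ?case .
qed simp

lemma binom_pair_neg_three_quarters:
  "64 ^ n * binom_pair n (-3/4) * (fact (2 * n) * (fact n)\<^sup>2) = fact (4 * n)"
proof (induction n)
  case (Suc n)
  have f2: "fact (2 * Suc n) = (2 * of_nat n + 1) * (2 * of_nat n + 2) * (fact (2 * n) :: rat)"
    by (simp add: algebra_simps eval_nat_numeral)
  have "64 ^ Suc n * binom_pair (Suc n) (-3/4) * (fact (2 * Suc n) * (fact (Suc n))\<^sup>2) =
      (64 ^ n * binom_pair n (-3/4) * (fact (2 * n) * (fact n)\<^sup>2))
        * ((4 * of_nat n + 1) * (4 * of_nat n + 2) * (4 * of_nat n + 3) * (4 * of_nat n + 4))"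
    unfolding f2
    by (simp add: binom_pair_Suc divide_simps del: of_nat_Suc)
       (simp add: algebra_simps eval_nat_numeral)
  also have "\<dots> = fact (4 * Suc n)"
    unfolding Suc.IH by (simp add: algebra_simps eval_nat_numeral)
  finally show ?case .
qed simp

lemma binom_pair_neg_five_sixths:
  "432 ^ n * binom_pair n (-5/6) * (fact (3 * n) * fact (2 * n) * fact n) = fact (6 * n)"
proof (induction n)
  case (Suc n)
  have f2: "fact (2 * Suc n) = (2 * of_nat n + 1) * (2 * of_nat n + 2) * (fact (2 * n) :: rat)"
    by (simp add: algebra_simps eval_nat_numeral)
  have f3: "fact (3 * Suc n) =
      (3 * of_nat n + 1) * (3 * of_nat n + 2) * (3 * of_nat n + 3) * (fact (3 * n) :: rat)"
    by (simp add: algebra_simps eval_nat_numeral)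
  have "432 ^ Suc n * binom_pair (Suc n) (-5/6) * (fact (3 * Suc n) * fact (2 * Suc n) * fact (Suc n)) =
      (432 ^ n * binom_pair n (-5/6) * (fact (3 * n) * fact (2 * n) * fact n))
        * ((6 * of_nat n + 1) * (6 * of_nat n + 2) * (6 * of_nat n + 3)
          * (6 * of_nat n + 4) * (6 * of_nat n + 5) * (6 * of_nat n + 6))"
    unfolding f2 f3
    by (simp add: binom_pair_Suc divide_simps del: of_nat_Suc)
       (simp add: algebra_simps eval_nat_numeral)
  also have "\<dots> = fact (6 * Suc n)"
    unfolding Suc.IH by (simp add: algebra_simps eval_nat_numeral)
  finally show ?case .
qed simp

section \<open>Factorials of multiples of \<open>p\<close> modulo \<open>p ^ 3\<close>\<close>

context prime_gt_3
begin

text \<open>The product of the integers strictly between \<open>m p\<close> and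
  \<open>(m + 1) p\<close>, divided by \<open>(p - 1)!\<close>.\<close>

definition block :: "nat \<Rightarrow> rat" where
  "block m = (\<Prod>i=1..p-1. 1 + of_nat m * of_nat p / of_nat i)"

text \<open>In the square of the block, pairing \<open>i\<close> with \<open>p - i\<close> leaves
  factors \<open>1 + (m + m^2) p^2 / (i (p - i))\<close>. Modulo \<open>p\<close> the sum of
  \<open>1 / (i (p - i))\<close> is minus that of the inverse squares, so the square is 1 modulo
  \<open>p ^ 3\<close>.\<close>

lemma block_cong: "block m - 1 \<in> I 3"
proof -
  define P where "P = (of_nat p :: rat)"
  have P1: "P \<in> I 1" using ideal_p_power[of 1] by (simp add: P_def)
  have P2: "P\<^sup>2 \<in> I 2" using ideal_p_power[of 2] by (simp add: P_def)
  define b where "b i = (1 / (of_nat i * of_nat (p - i)) :: rat)" for i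
  have units: "\<not> p dvd i" "\<not> p dvd p - i" if "i \<in> {1..p-1}" for i
  proof -
    have "1 \<le> p - i" "p - i \<le> p - 1" using that p_gt_3 by auto
    then show "\<not> p dvd p - i" by (rule unit_below_p)
    show "\<not> p dvd i" using that by (intro unit_below_p) auto
  qed
  have b: "b i \<in> Z" if "i \<in> {1..p-1}" for i
    using Zp_mult[OF Zp_inverse_of_nat[OF units(1)[OF that]] Zp_inverse_of_nat[OF units(2)[OF that]]]
    by (simp add: b_def)
  have "(\<Sum>i=1..p-1. b i + 1 / (of_nat i)\<^sup>2) \<in> I 1"
  proof (rule ideal_sum)
    fix i assume i: "i \<in> {1..p-1}"
    define j where "j = (of_nat (p - i) :: rat)"
    have "P = of_nat i + j" "(of_nat i :: rat) \<noteq> 0" "j \<noteq> 0"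
      using i by (auto simp: j_def P_def simp flip: of_nat_add)
    then have "b i + 1 / (of_nat i)\<^sup>2 = P * b i * (1 / of_nat i)"
      unfolding b_def j_def[symmetric] by (simp add: field_simps power2_eq_square)
    also have "\<dots> \<in> I 1"
      by (rule ideal_mult_right[OF ideal_mult_right[OF P1 b[OF i]] Zp_inverse_of_nat[OF units(1)[OF i]]])
    finally show "b i + 1 / (of_nat i)\<^sup>2 \<in> I 1" .
  qed
  from ideal_diff[OF this sum_inverse_squares] have "(\<Sum>i=1..p-1. b i) \<in> I 1"
    by (simp add: sum.distrib)
  then have "(of_nat m + of_nat m ^ 2) * (P\<^sup>2 * (\<Sum>i=1..p-1. b i)) \<in> I 3"
    by (intro ideal_mult_left ideal_mult_2_1 P2 Zp_add Zp_power Zp_of_nat)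
  then have sum: "(\<Sum>i=1..p-1. (of_nat m + of_nat m ^ 2) * P\<^sup>2 * b i) \<in> I 3"
    by (simp add: sum_distrib_left mult.assoc)
  have "block m * block m = block m * (\<Prod>i=1..p-1. 1 + of_nat m * P / of_nat (p - i))"
    unfolding mult_cancel_left block_def P_def
    by (intro disjI2 prod.reindex_bij_witness[of _ "\<lambda>i. p - i" "\<lambda>i. p - i"]) auto
  also have "\<dots> = (\<Prod>i=1..p-1. 1 + (of_nat m + of_nat m ^ 2) * P\<^sup>2 * b i)"
    unfolding block_def P_def[symmetric] prod.distrib[symmetric]
  proof (intro prod.cong refl)
    fix i assume i: "i \<in> {1..p-1}"
    define j where "j = (of_nat (p - i) :: rat)"
    have ij: "P = of_nat i + j" "(of_nat i :: rat) \<noteq> 0" "j \<noteq> 0"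
      using i by (auto simp: j_def P_def simp flip: of_nat_add)
    then show "(1 + of_nat m * P / of_nat i) * (1 + of_nat m * P / of_nat (p - i)) =
        1 + (of_nat m + of_nat m ^ 2) * P\<^sup>2 * b i"
      unfolding b_def j_def[symmetric] by (simp add: divide_simps) (simp add: algebra_simps power2_eq_square)
  qed
  also have "\<dots> - (1 + (\<Sum>i=1..p-1. (of_nat m + of_nat m ^ 2) * P\<^sup>2 * b i)) \<in> I 3"
    using b by (intro prod_one_plus_cong ideal_mult_right ideal_mult_left P2 Zp_add Zp_power) auto
  finally have "block m * block m - 1 \<in> I 3" using ideal_add[OF _ sum] by fastforce
  then have sq: "(block m + 1) * (block m - 1) \<in> I 3" by (simp add: algebra_simps)
  have blockZ: "block m \<in> Z"
    unfolding block_def using units by (intro Zp_prod Zp_add Zp_divide_of_nat Zp_mult) auto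
  have block1: "block m - 1 \<in> I 1"
  proof -
    have "prod (\<lambda>i. 1 + of_nat m * P / of_nat i) A - 1 \<in> I 1" if "A \<subseteq> {1..p-1}" for A
      using finite_subset[OF that finite_atLeastAtMost] that
    proof (induction A rule: finite_induct)
      case (insert i A)
      have a: "of_nat m * P / of_nat i \<in> I 1"
        using ideal_mult_left[OF Zp_of_nat P1, of m] units(1)[of i] insert.prems
          ideal_divide_of_nat_power[of _ 1 i 1] by auto
      have "(1 + of_nat m * P / of_nat i) * (prod (\<lambda>i. 1 + of_nat m * P / of_nat i) A - 1)
          + of_nat m * P / of_nat i \<in> I 1"
        using insert ideal_subset_Zp[OF a] by (intro ideal_add ideal_mult_left Zp_add a) auto
      then show ?case using insert by (simp add: algebra_simps)
    qed simp
    then show ?thesis unfolding block_def P_def by simp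
  qed
  \<comment> \<open>\<open>block m + 1\<close> is 2 modulo \<open>p\<close>, hence a unit that can
    be cancelled from \<open>block m ^ 2 - 1\<close>.\<close>
  have notI: "block m + 1 \<notin> I 1"
  proof
    assume "block m + 1 \<in> I 1"
    from ideal_diff[OF this block1] have "of_nat 2 * 1 \<in> I 1" by simp
    moreover have "\<not> p dvd 2" using p_gt_3 by (auto dest: dvd_imp_le)
    ultimately show False using one_notin_ideal ideal_cancel_of_nat by blast
  qed
  show ?thesis
  proof (rule ideal_cancel[OF _ _ sq])
    show "1 / (block m + 1) \<in> Z" using notI blockZ by (intro Zp_inverse Zp_add) auto
    show "block m + 1 \<noteq> 0" using notI by (metis ideal_zero)
  qed
qed

lemma one_plus_ideal_mult:
  assumes "a - 1 \<in> I m" "b - 1 \<in> I m"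
  shows "a * b - 1 \<in> I m"
proof -
  have "a * b - 1 = (a - 1) * (b - 1) + (a - 1) + (b - 1)" by (simp add: algebra_simps)
  also have "\<dots> \<in> I m"
    using assms by (intro ideal_add ideal_mult_left) (auto intro: ideal_subset_Zp)
  finally show ?thesis .
qed

definition fact_unit :: "nat \<Rightarrow> rat" where "fact_unit m = (\<Prod>j<m. block j)"

lemma fact_unit_cong: "fact_unit m - 1 \<in> I 3"
  unfolding fact_unit_def
  by (induction m) (auto intro: one_plus_ideal_mult block_cong)

text \<open>The multiples of \<open>p\<close> contribute \<open>p ^ m * m!\<close>, and each gap
  between them one block.\<close>

lemma fact_mult_p:
  "fact (m * p) = fact m * (of_nat p * fact (p - 1)) ^ m * fact_unit m"
proof (induction m)
  case (Suc m)
  have p: "{1..p} = insert p {1..p-1}" using p_gt_3 by auto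
  have "(\<Prod>i=1..p-1. of_nat (m * p) + of_nat i) = (\<Prod>i=1..p-1. of_nat i * (1 + (of_nat m :: rat) * of_nat p / of_nat i))"
    by (intro prod.cong) (auto simp: field_simps)
  also have "\<dots> = fact (p - 1) * block m"
    unfolding prod.distrib block_def fact_prod by simp
  finally have *: "(\<Prod>i=1..p-1. of_nat (m * p) + of_nat i) = fact (p - 1) * block m" .
  have "fact (Suc m * p) = (fact (m * p + p) :: rat)" by (simp add: add.commute)
  also have "\<dots> = fact (m * p) * ((of_nat (m * p) + of_nat p) * (fact (p - 1) * block m))"
    unfolding fact_add_rat p *[symmetric] using p_gt_3 by (subst prod.insert) auto
  also have "\<dots> = fact (Suc m) * (of_nat p * fact (p - 1)) ^ Suc m * fact_unit (Suc m)"
    unfolding Suc.IH by (simp add: fact_unit_def algebra_simps)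
  finally show ?case .
qed (simp add: fact_unit_def)

lemma cong_of_unit_quotient:
  assumes "X * v = w * u" "u - 1 \<in> I m" "v - 1 \<in> I m" "X \<in> Z" "w \<in> Z"
  shows "X - w \<in> I m"
proof -
  have "X - w = w * (u - 1) - X * (v - 1)" using assms(1) by (simp add: algebra_simps)
  also have "\<dots> \<in> I m"
    using assms by (intro ideal_diff[OF ideal_mult_left ideal_mult_left])
  finally show ?thesis .
qed

lemma not_p_dvd: "\<not> p dvd 2" "\<not> p dvd 3" "\<not> p dvd 4" "\<not> p dvd 6" "p \<noteq> 5 \<Longrightarrow> \<not> p dvd 5"
proof -
  show *: "\<not> p dvd 2" "\<not> p dvd 3" using p_gt_3 by (auto dest: dvd_imp_le)
  show "\<not> p dvd 4" using * prime_p prime_dvd_mult_iff[of p 2 2] by auto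
  show "\<not> p dvd 6" using * prime_p prime_dvd_mult_iff[of p 2 3] by auto
  show "p \<noteq> 5 \<Longrightarrow> \<not> p dvd 5"
    using prime_p p_gt_3 primes_dvd_imp_eq[of p 5] by auto
qed

lemma Zp_neg_fraction: "\<not> p dvd d \<Longrightarrow> - of_nat a / of_nat d \<in> Z"
  by (intro Zp_divide_of_nat Zp_uminus Zp_of_nat)

lemma fact_p: "(fact p :: rat) = of_nat p * fact (p - 1)"
  by (simp add: fact_num_eq_if)

text \<open>By \<open>fact_mult_p\<close> the powers of \<open>q = p!\<close> cancel and the units
  are 1 modulo \<open>p ^ 3\<close>, so the quotient behaves as for \<open>n = 1\<close>: the
  constants of the four congruences are \<open>2!^2 = 4\<close>, \<open>3! = 6\<close>,
  \<open>4!/2! = 12\<close> and \<open>6!/(3! 2!) = 60\<close>.\<close>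

lemma binom_pair_neg_half_cong: "16 ^ p * binom_pair p (-1/2) - 4 \<in> I 3"
proof (rule cong_of_unit_quotient)
  define q where "q = (of_nat p * fact (p - 1) :: rat)"
  have q: "q \<noteq> 0" by (simp add: q_def)
  have facts: "fact p = q" "fact (2 * p) = 2 * q ^ 2 * fact_unit 2"
    using fact_p fact_mult_p[of 2] by (simp_all add: q_def fact_numeral)
  have "(q ^ 4) * (16 ^ p * binom_pair p (-1/2) * 1) = (q ^ 4) * (4 * (fact_unit 2 * fact_unit 2))"
    using binom_pair_neg_half[of p] unfolding facts by (simp add: algebra_simps eval_nat_numeral)
  then show "16 ^ p * binom_pair p (-1/2) * 1 = 4 * (fact_unit 2 * fact_unit 2)"
    unfolding mult_cancel_left using q by simp
  show "1 - 1 \<in> I 3" "(fact_unit 2 * fact_unit 2) - 1 \<in> I 3"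
    by (simp_all add: one_plus_ideal_mult fact_unit_cong)
  show "16 ^ p * binom_pair p (-1/2) \<in> Z"
    using Zp_neg_fraction[OF not_p_dvd(1), of 1] by (intro Zp_mult Zp_power binom_pair_in_Zp) auto
qed simp

lemma binom_pair_neg_two_thirds_cong: "27 ^ p * binom_pair p (-2/3) - 6 \<in> I 3"
proof (rule cong_of_unit_quotient)
  define q where "q = (of_nat p * fact (p - 1) :: rat)"
  have q: "q \<noteq> 0" by (simp add: q_def)
  have facts: "fact p = q" "fact (3 * p) = 6 * q ^ 3 * fact_unit 3"
    using fact_p fact_mult_p[of 3] by (simp_all add: q_def fact_numeral)
  have "(q ^ 3) * (27 ^ p * binom_pair p (-2/3) * 1) = (q ^ 3) * (6 * fact_unit 3)"
    using binom_pair_neg_two_thirds[of p] unfolding facts by (simp add: algebra_simps eval_nat_numeral)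
  then show "27 ^ p * binom_pair p (-2/3) * 1 = 6 * fact_unit 3"
    unfolding mult_cancel_left using q by simp
  show "1 - 1 \<in> I 3" "fact_unit 3 - 1 \<in> I 3"
    by (simp_all add: one_plus_ideal_mult fact_unit_cong)
  show "27 ^ p * binom_pair p (-2/3) \<in> Z"
    using Zp_neg_fraction[OF not_p_dvd(2), of 2] by (intro Zp_mult Zp_power binom_pair_in_Zp) auto
qed simp

lemma binom_pair_neg_three_quarters_cong: "64 ^ p * binom_pair p (-3/4) - 12 \<in> I 3"
proof (rule cong_of_unit_quotient)
  define q where "q = (of_nat p * fact (p - 1) :: rat)"
  have q: "q \<noteq> 0" by (simp add: q_def)
  have facts: "fact p = q" "fact (2 * p) = 2 * q ^ 2 * fact_unit 2" "fact (4 * p) = 24 * q ^ 4 * fact_unit 4"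
    using fact_p fact_mult_p[of 2] fact_mult_p[of 4] by (simp_all add: q_def fact_numeral)
  have "(2 * q ^ 4) * (64 ^ p * binom_pair p (-3/4) * fact_unit 2) = (2 * q ^ 4) * (12 * fact_unit 4)"
    using binom_pair_neg_three_quarters[of p] unfolding facts by (simp add: algebra_simps eval_nat_numeral)
  then show "64 ^ p * binom_pair p (-3/4) * fact_unit 2 = 12 * fact_unit 4"
    unfolding mult_cancel_left using q by simp
  show "fact_unit 2 - 1 \<in> I 3" "fact_unit 4 - 1 \<in> I 3"
    by (simp_all add: one_plus_ideal_mult fact_unit_cong)
  show "64 ^ p * binom_pair p (-3/4) \<in> Z"
    using Zp_neg_fraction[OF not_p_dvd(3), of 3] by (intro Zp_mult Zp_power binom_pair_in_Zp) auto
qed simp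

lemma binom_pair_neg_five_sixths_cong: "432 ^ p * binom_pair p (-5/6) - 60 \<in> I 3"
proof (rule cong_of_unit_quotient)
  define q where "q = (of_nat p * fact (p - 1) :: rat)"
  have q: "q \<noteq> 0" by (simp add: q_def)
  have facts: "fact p = q" "fact (2 * p) = 2 * q ^ 2 * fact_unit 2" "fact (3 * p) = 6 * q ^ 3 * fact_unit 3" "fact (6 * p) = 720 * q ^ 6 * fact_unit 6"
    using fact_p fact_mult_p[of 2] fact_mult_p[of 3] fact_mult_p[of 6] by (simp_all add: q_def fact_numeral)
  have "(12 * q ^ 6) * (432 ^ p * binom_pair p (-5/6) * (fact_unit 3 * fact_unit 2)) = (12 * q ^ 6) * (60 * fact_unit 6)"
    using binom_pair_neg_five_sixths[of p] unfolding facts by (simp add: algebra_simps eval_nat_numeral)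
  then show "432 ^ p * binom_pair p (-5/6) * (fact_unit 3 * fact_unit 2) = 60 * fact_unit 6"
    unfolding mult_cancel_left using q by simp
  show "(fact_unit 3 * fact_unit 2) - 1 \<in> I 3" "fact_unit 6 - 1 \<in> I 3"
    by (simp_all add: one_plus_ideal_mult fact_unit_cong)
  show "432 ^ p * binom_pair p (-5/6) \<in> Z"
    using Zp_neg_fraction[OF not_p_dvd(4), of 5] by (intro Zp_mult Zp_power binom_pair_in_Zp) auto
qed simp

text \<open>The factors \<open>(i + p) / (i - p)\<close> multiplicatively interpolate \<open>E\<close>, while the product
  telescopes to a multiple of \<open>binom_pair p\<close>.\<close>

definition D :: "nat \<Rightarrow> rat" where
  "D n = (\<Prod>i=1..n. if p dvd i then 1 else (of_nat i + of_nat p) / (of_nat i - of_nat p))"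

lemma D_Suc: "D (Suc n) =
  D n * (if p dvd Suc n then 1 else (of_nat (Suc n) + of_nat p) / (of_nat (Suc n) - of_nat p))"
  by (simp add: D_def del: of_nat_Suc)

lemma D_Suc_unit:
  assumes "\<not> p dvd Suc n"
  shows "(of_nat (Suc n) - of_nat p) * D (Suc n) = (of_nat (Suc n) + of_nat p) * D n"
proof -
  have "(of_nat (Suc n) - of_nat p :: rat) \<noteq> 0" using assms by (metis dvd_refl eq_iff_diff_eq_0 of_nat_eq_iff)
  then show ?thesis using assms by (simp add: D_Suc del: of_nat_Suc)
qed

text \<open>At a unit \<open>i\<close>, the factor \<open>(i + p)/(i - p)\<close> agrees modulo
  \<open>p ^ 3\<close> with the growth of the truncated exponential; at a multiple of
  \<open>p\<close> neither side changes modulo \<open>p ^ 3\<close>.\<close>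

lemma D_cong: "D n - E (-1 - of_nat n) \<in> I 3"
proof (induction n)
  case 0
  show ?case using T_eq_tau[of 0] by (simp add: D_def E_def)
next
  case (Suc n)
  define P where "P = (of_nat p :: rat)"
  define i where "i = (of_nat (Suc n) :: rat)"
  define e where "e m = 1 + 2 * P * tau m + 2 * P\<^sup>2 * (tau m)\<^sup>2" for m
  have E: "E (-1 - of_nat m) = e m" for m by (simp add: E_def T_eq_tau e_def P_def)
  have P3: "P ^ 3 \<in> I 3" unfolding P_def by (rule ideal_p_power)
  have PZ: "P \<in> Z" by (simp add: P_def)
  have IH: "D n - e n \<in> I 3" using Suc.IH unfolding E .
  have "D (Suc n) - e (Suc n) \<in> I 3"
  proof (cases "p dvd Suc n")
    case True
    have "e (Suc n) - e n = 2 * t (Suc n) * P * (1 + P * (2 * tau n + t (Suc n)))"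
      by (simp add: e_def tau_Suc algebra_simps power2_eq_square)
    also have "\<dots> \<in> I 3"
      using True PZ by (intro ideal_mult_right ideal_mult_left t_of_multiple Zp_add Zp_mult) auto
    finally have "e (Suc n) - e n \<in> I 3" .
    from ideal_diff[OF IH this] show ?thesis using True by (simp add: D_Suc)
  next
    case False
    define u where "u = i * t (Suc n) - 1"
    have u: "u \<in> I 3" unfolding u_def i_def by (rule t_of_unit[OF False])
    have it: "i * t (Suc n) = 1 + u" by (simp add: u_def)
    have ip: "i - P = of_int (int (Suc n) - int p)" by (simp add: i_def P_def)
    have ndvd: "\<not> int p dvd int (Suc n) - int p"
      using False by (metis diff_add_cancel dvd_add dvd_refl int_dvd_int_iff)
    then have inv: "1 / (i - P) \<in> Z" and nz: "i - P \<noteq> 0"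
      unfolding ip by (rule Zp_inverse_of_int, metis dvd_0_right of_int_eq_0_iff)
    have "(i - P) * (D (Suc n) - e (Suc n)) = (i + P) * D n - (i - P) * e (Suc n)"
      unfolding right_diff_distrib using D_Suc_unit[OF False] by (simp only: i_def P_def)
    also have "\<dots> = (i + P) * (D n - e n) + (i * (e n - e (Suc n)) + P * (e n + e (Suc n)))"
      by (simp add: algebra_simps)
    \<comment> \<open>Once \<open>i * t (Suc n)\<close> is replaced by \<open>1 + u\<close>, the
      terms of degree one and two in \<open>P\<close> cancel, leaving multiples of
      \<open>P ^ 3\<close> and \<open>u\<close>.\<close>
    also have "i * (e n - e (Suc n)) = - 2 * (i * t (Suc n)) * (P + P\<^sup>2 * (2 * tau n + t (Suc n)))"
      by (simp add: e_def tau_Suc algebra_simps power2_eq_square)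
    also have "\<dots> + P * (e n + e (Suc n)) =
        2 * (tau n ^ 2 + tau (Suc n) ^ 2) * P ^ 3 - 2 * (P + P\<^sup>2 * (2 * tau n + t (Suc n))) * u"
      unfolding it by (simp add: e_def tau_Suc algebra_simps power2_eq_square power3_eq_cube)
    also have "(i + P) * (D n - e n) + \<dots> \<in> I 3"
      using PZ by (intro ideal_add ideal_diff ideal_mult_left[OF _ IH] ideal_mult_left[OF _ P3]
          ideal_mult_left[OF _ u] Zp_add Zp_mult Zp_power) (auto simp: i_def simp del: of_nat_Suc)
    finally show ?thesis by (rule ideal_cancel[OF inv nz])
  qed
  then show ?case unfolding E .
qed

text \<open>Reversing the product of the \<open>i - p\<close> gives \<open>(p - 1)!\<close> up to
  sign; passing to squares makes the sign irrelevant.\<close>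

lemma D_p: "D (p - 1) = sine_prod (p - 1) (of_nat p)"
proof -
  define a b c where "a = (\<Prod>i=1..p-1. of_nat i - of_nat p :: rat)"
    and "b = (\<Prod>i=1..p-1. of_nat i + of_nat p :: rat)" and "c = (\<Prod>i=1..p-1. of_nat i :: rat)"
  have a: "a = (\<Prod>i=1..p-1. - of_nat i)"
    unfolding a_def by (subst prod.atLeastAtMost_rev) (auto intro!: prod.cong simp: of_nat_diff)
  have a2: "a\<^sup>2 = c\<^sup>2"
    unfolding a c_def power2_eq_square prod.distrib[symmetric] by simp
  have "c \<noteq> 0" unfolding c_def by simp
  then have "a \<noteq> 0" using a2 by auto
  have "D (p - 1) = b / a"
    unfolding D_def a_def b_def prod_dividef[symmetric]
    using unit_below_p by (intro prod.cong) auto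
  also have "\<dots> = a * b / a\<^sup>2" using \<open>a \<noteq> 0\<close> by (simp add: power2_eq_square)
  also have "\<dots> = (a / c) * (b / c)" unfolding a2 by (simp add: power2_eq_square)
  also have "\<dots> = sine_prod (p - 1) (of_nat p)"
    unfolding a_def b_def c_def sine_prod_def prod_dividef[symmetric] prod.distrib[symmetric]
    by (intro prod.cong) (auto simp: field_simps power2_eq_square)
  finally show ?thesis .
qed

text \<open>The recurrence \<open>(x - p) h(x) = (x + p) h(x - 1)\<close> governs the right side.
  Between multiples of \<open>p\<close> it is carried by \<open>D\<close>; at
  \<open>x = p (q + 1)\<close> the value of \<open>D\<close> is unchanged and
  \<open>q (q + 1)\<close> becomes \<open>(q + 1) (q + 2)\<close>.\<close>

lemma D_mult: "D n * (of_nat (n div p) * (of_nat (n div p) + 1)) = - binom_pair p (of_nat n)"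
proof (induction n)
  case 0
  show ?case using p_gt_3 by (simp add: binom_pair_zero)
next
  case (Suc n)
  define q where "q = (of_nat (n div p) :: rat)"
  define x where "x = (of_nat (Suc n) :: rat)"
  have "x - 1 = of_nat n" by (simp add: x_def)
  then have IH: "D n * (q * (q + 1)) = - binom_pair p (x - 1)" using Suc.IH by (simp add: q_def)
  have p1: "p \<ge> 1" using p_gt_3 by simp
  have rec: "(x - of_nat p) * binom_pair p x = (x + of_nat p) * binom_pair p (x - 1)"
    unfolding binom_pair_diff_1_eq_sine_prod[OF p1] binom_pair_eq_sine_prod[OF p1, of x] by simp
  show ?case
  proof (cases "p dvd Suc n")
    case False
    then have "Suc n div p = n div p" by (simp add: div_Suc dvd_eq_mod_eq_0)
    moreover have nz: "x \<noteq> of_nat p" using False unfolding x_def by (metis dvd_refl of_nat_eq_iff)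
    ultimately have "(x - of_nat p) * (D (Suc n) * (of_nat (Suc n div p) * (of_nat (Suc n div p) + 1))) =
        (x + of_nat p) * (D n * (q * (q + 1)))"
      using D_Suc_unit[OF False] unfolding x_def[symmetric] q_def by (simp only: mult.assoc[symmetric])
    also have "\<dots> = (x - of_nat p) * - binom_pair p x" unfolding IH using rec by simp
    finally show ?thesis using nz unfolding mult_cancel_left by (simp add: x_def)
  next
    case True
    then have div: "Suc n div p = Suc (n div p)" by (simp add: div_Suc dvd_eq_mod_eq_0)
    have "Suc n = p * Suc (n div p)" using True div by (metis dvd_mult_div_cancel)
    then have x: "x = of_nat p * (q + 1)"
      unfolding x_def q_def by (metis add.commute of_nat_Suc of_nat_mult)
    \<comment> \<open>At \<open>x = p\<close> the recurrence degenerates to \<open>0 = 0\<close>, so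
      this value is computed directly from \<open>D_p\<close>.\<close>
    show ?thesis
    proof (cases "n div p = 0")
      case True
      then have "Suc n = p" using \<open>Suc n = p * Suc (n div p)\<close> by simp
      moreover from this have "n = p - 1" by simp
      ultimately have "D (Suc n) = D (p - 1)" "x = of_nat p"
        using D_Suc[of n] by (simp_all only: x_def dvd_refl if_True mult_1_right)
      then show ?thesis unfolding div x_def[symmetric] True by (simp add: D_p binom_pair_p_p del: One_nat_def)
    next
      case False
      then have "q \<noteq> 0" by (simp add: q_def)
      have "of_nat p * q * binom_pair p x = of_nat p * (q + 2) * binom_pair p (x - 1)"
        using rec unfolding x by (simp add: algebra_simps)
      also have "binom_pair p (x - 1) = - (D n * (q * (q + 1)))" using IH by simp
      finally have "(of_nat p * q) * binom_pair p x = (of_nat p * q) * - (D n * ((q + 1) * (q + 2)))"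
        by (simp add: algebra_simps)
      then have "binom_pair p x = - (D n * ((q + 1) * (q + 2)))"
        unfolding mult_cancel_left using \<open>q \<noteq> 0\<close> by simp
      then show ?thesis unfolding div x_def[symmetric] using True
        by (simp add: D_Suc q_def algebra_simps)
    qed
  qed
qed

text \<open>\<open>n div p\<close> is not polynomial in \<open>n\<close>. With the residue
  \<open>r\<close> fixed it equals \<open>y\<close> itself, so density is applied in
  \<open>y\<close>.\<close>

lemma E_mult_cong:
  assumes "y \<in> Z" "r < p"
  shows "E (-1 - (of_nat r + of_nat p * y)) * (y * (y + 1))
    + binom_pair p (of_nat r + of_nat p * y) \<in> I 3"
proof (rule ideal_by_density[OF _ _ assms(1)])
  show "lip (\<lambda>y. E (-1 - (of_nat r + of_nat p * y)) * (y * (y + 1))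
      + binom_pair p (of_nat r + of_nat p * y))"
    by (intro lip_intros lip_E lip_binom_pair)
  fix m :: nat
  define n where "n = r + p * m"
  have "n div p = m" using assms(2) by (simp add: n_def)
  then have D: "D n * (of_nat m * (of_nat m + 1)) = - binom_pair p (of_nat n)"
    using D_mult[of n] by simp
  have "- ((D n - E (-1 - of_nat n)) * (of_nat m * (of_nat m + 1))) \<in> I 3"
    by (intro ideal_uminus ideal_mult_right D_cong Zp_mult Zp_add) auto
  then have "E (-1 - of_nat n) * (of_nat m * (of_nat m + 1)) + binom_pair p (of_nat n) \<in> I 3"
    unfolding left_diff_distrib D by (simp add: add.commute)
  then show "E (-1 - (of_nat r + of_nat p * of_nat m)) * (of_nat m * (of_nat m + 1))
      + binom_pair p (of_nat r + of_nat p * of_nat m) \<in> I 3"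
    by (simp add: n_def)
qed

text \<open>With \<open>y = - j/d\<close>, \<open>c\<close> is the inverse of \<open>- y (y + 1)\<close>.\<close>

lemma V_poly_at_fraction:
  assumes d: "\<not> p dvd d" and eq: "d * r + a = p * j" and r: "r < p"
    and z: "z = - of_nat a / of_nat d"
    and c: "c \<in> Z" "c * (of_nat j * (of_nat d - of_nat j)) = (of_nat d)\<^sup>2"
    and w: "of_nat K ^ p * binom_pair p z - w \<in> I 3"
    and v: "v = w * c - 2 * w" and x: "x = -1 - z"
  shows "Zp_cong p 3 (of_nat K ^ p * V_poly p x) v"
proof (rule Zp_congI)
  \<comment> \<open>The equation \<open>d r + a = p j\<close> makes this the solution of
    \<open>z = r + p y\<close>.\<close>
  define y where "y = (- of_nat j / of_nat d :: rat)"
  have d0: "(of_nat d :: rat) \<noteq> 0" using d by (intro notI) simp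
  have yZ: "y \<in> Z" and zZ: "z \<in> Z" unfolding y_def z by (intro Zp_neg_fraction d)+
  have "of_nat d * of_nat r + of_nat a = (of_nat p * of_nat j :: rat)"
    using eq by (metis of_nat_add of_nat_mult)
  then have zy: "z = of_nat r + of_nat p * y" unfolding z y_def using d0 by (simp add: field_simps)
  have cy: "c * (y * (y + 1)) = -1"
  proof -
    have "c * (y * (y + 1)) = - (c * (of_nat j * (of_nat d - of_nat j))) / (of_nat d)\<^sup>2"
      unfolding y_def using d0 by (simp add: field_simps power2_eq_square)
    then show ?thesis using d0 unfolding c(2) by simp
  qed
  define B where "B = binom_pair p z"
  have "c * (E x * (y * (y + 1)) + B) \<in> I 3"
    using E_mult_cong[OF yZ r] unfolding x B_def zy by (intro ideal_mult_left c(1))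
  also have "c * (E x * (y * (y + 1)) + B) = c * B + E x * (c * (y * (y + 1)))"
    by (simp add: algebra_simps)
  finally have EB: "c * B - E x \<in> I 3" unfolding cy by simp
  \<comment> \<open>Combines \<open>V = E - 2 B\<close> with \<open>E = c B\<close>, both modulo
    \<open>p ^ 3\<close>, where \<open>K ^ p * B\<close> is congruent to \<open>w\<close>.\<close>
  have "of_nat K ^ p * V_poly p x - v =
      of_nat K ^ p * (V_poly p x - (E x - 2 * B)) - of_nat K ^ p * (c * B - E x)
        + (c - 2) * (of_nat K ^ p * B - w)"
    unfolding v by (simp add: algebra_simps)
  also have "\<dots> \<in> I 3"
    using V_poly_cong[OF zZ] EB w c(1) unfolding x B_def
    by (intro ideal_add ideal_diff[OF ideal_mult_left ideal_mult_left] ideal_mult_left[OF _ w]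
        Zp_power Zp_diff) auto
  finally show "of_nat K ^ p * V_poly p x - v \<in> I 3" .
  have "x \<in> Z" unfolding x using zZ by (intro Zp_diff Zp_uminus Zp_1)
  then show "of_nat K ^ p * V_poly p x \<in> Z" by (intro Zp_mult Zp_power V_poly_in_Zp Zp_of_nat)
qed

section \<open>The four numerical congruences\<close>

lemma p_odd: "p mod 2 = 1" and p_mod_3: "p mod 3 \<noteq> 0"
proof -
  have "\<not> 2 dvd p" "\<not> 3 dvd p"
    using prime_p p_gt_3 primes_dvd_imp_eq[of 2 p] primes_dvd_imp_eq[of 3 p] by auto
  then show "p mod 2 = 1" "p mod 3 \<noteq> 0" by presburger+
qed

lemma V_cong: "Zp_cong p 3 (V p) 8"
proof -
  have "\<exists>r. 2 * r + 1 = p * 1 \<and> r < p" using p_odd by presburger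
  then obtain r where "2 * r + 1 = p * 1" "r < p" by blast
  from V_poly_at_fraction[OF not_p_dvd(1) this, where K = 16 and z = "-1/2" and c = 4 and w = 4]
  show ?thesis using binom_pair_neg_half_cong by (simp add: V_def)
qed

lemma V3_cong: "Zp_cong p 3 (V3 p) 15"
proof -
  \<comment> \<open>The class of \<open>p\<close> modulo 3 selects \<open>j\<close>; both choices
    give \<open>j (3 - j) = 2\<close>, hence the same \<open>c = 9/2\<close>. The moduli 4 and 6
    below work alike.\<close>
  have "(\<exists>r. 3 * r + 2 = p * 1 \<and> r < p) \<or> (\<exists>r. 3 * r + 2 = p * 2 \<and> r < p)"
    using p_mod_3 by presburger
  then obtain j r where j: "j = 1 \<or> j = 2" and r: "3 * r + 2 = p * j" "r < p" by metis
  have "9 / of_nat 2 \<in> Z" by (intro Zp_divide_of_nat not_p_dvd) simp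
  with j V_poly_at_fraction[OF not_p_dvd(2) r, where K = 27 and z = "-2/3" and c = "9/2" and w = 6]
  show ?thesis using binom_pair_neg_two_thirds_cong by (auto simp: V3_def)
qed

lemma V4_cong: "Zp_cong p 3 (V4 p) 40"
proof -
  have "(\<exists>r. 4 * r + 3 = p * 1 \<and> r < p) \<or> (\<exists>r. 4 * r + 3 = p * 3 \<and> r < p)"
    using p_odd by presburger
  then obtain j r where j: "j = 1 \<or> j = 3" and r: "4 * r + 3 = p * j" "r < p" by metis
  have "16 / of_nat 3 \<in> Z" by (intro Zp_divide_of_nat not_p_dvd) simp
  with j V_poly_at_fraction[OF not_p_dvd(3) r, where K = 64 and z = "-3/4" and c = "16/3" and w = 12]
  show ?thesis using binom_pair_neg_three_quarters_cong by (auto simp: V4_def)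
qed

lemma V6_cong: "Zp_cong p 3 (V6 p) 312"
proof (cases "p = 5")
  case True
  \<comment> \<open>Here \<open>y (y + 1) = - 5/36\<close> is not a unit, so the value is computed.\<close>
  have "V_poly 5 (-1 - (-5/6)) = 7102429365312 / 432 ^ 5"
    unfolding V_poly_eq_binom_pair by (simp add: eval_nat_numeral binom_pair_Suc)
  then have "V6 p = 7102429365312" unfolding V6_def True by simp
  moreover have "(7102429365312 - 312 :: rat) \<in> I 3"
    using of_nat_mem_ideal[of 3 "7102429365312 - 312"] by (simp add: True)
  ultimately show ?thesis by (intro Zp_congI) simp_all
next
  case False
  have "(\<exists>r. 6 * r + 5 = p * 1 \<and> r < p) \<or> (\<exists>r. 6 * r + 5 = p * 5 \<and> r < p)"
    using p_odd p_mod_3 by presburger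
  then obtain j r where j: "j = 1 \<or> j = 5" and r: "6 * r + 5 = p * j" "r < p" by metis
  have "36 / of_nat 5 \<in> Z" using False by (intro Zp_divide_of_nat not_p_dvd) simp
  with j V_poly_at_fraction[OF not_p_dvd(4) r, where K = 432 and z = "-5/6" and c = "36/5" and w = 60]
  show ?thesis using binom_pair_neg_five_sixths_cong by (auto simp: V6_def)
qed

end

theorem theorem4p2:
  fixes p :: nat
  assumes "prime p" and "p > 3"
  shows "(\<forall>x\<in>Zp p. Zp_cong p 3 (V_poly p x)
            (1 - 2 * (x gchoose p) * ((-1 - x) gchoose p)
               + 2 * of_nat p * T p x + 2 * of_nat p ^ 2 * (T p x) ^ 2))
       \<and> Zp_cong p 3 (V p) 8
       \<and> Zp_cong p 3 (V3 p) 15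
       \<and> Zp_cong p 3 (V4 p) 40
       \<and> Zp_cong p 3 (V6 p) 312"
proof -
  interpret prime_gt_3 p using assms by unfold_locales
  show ?thesis using V_poly_Zp_cong V_cong V3_cong V4_cong V6_cong by blast
qed

end
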